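(* Let $F$ be a finite-dimensional real inner product space with norm $\|\cdot\|_F$, let $T>0$, let $C\subset F$ be nonempty, closed and convex, and let $\mathcal P:W^{1,1}([0,T];F)\to W^{1,1}([0,T];C)$ be the elastic-plastic history operator associated with $C$ (defined in the context). Then: (i) (Range preservation) $\mathcal P(\pi)(t)\in C$ for all $\pi\in W^{1,1}([0,T];F)$ and all $t\in[0,T]$. (ii) (Causality) If $\pi^1,\pi^2\in W^{1,1}([0,T];F)$ and $t_*\in[0,T]$ are such that $\pi^1=\pi^2$ on $[0,t_*]$, then $\mathcal P(\pi^1)=\mathcal P(\pi^2)$ on $[0,t_*]$. (iii) ($BV$-to-$L^\infty$ stability) For all $\pi^1,\pi^2\in W^{1,1}([0,T];F)$, $$\|\mathcal P(\pi^1)-\mathcal P(\pi^2)\|_{L^\infty([0,T];F)}\le\|\pi^1(0)-\pi^2(0)\|_F+\operatorname{Var}(\pi^1-\pi^2;[0,T]);$$ in particular $\|\mathcal P(\pi^1)-\mathcal P(\pi^2)\|_{L^\infty([0,T];F)}\le\|\pi^1-\pi^2\|_{BV,0}$. (iv) (Variation contraction) For all $\pi\in W^{1,1}([0,T];F)$, $$\operatorname{Var}(\mathcal P(\pi);[0,T])\le\operatorname{Var}(\pi;[0,T]).$$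
   Context: $\operatorname{Var}(u;[0,T])=\sup\sum_j\|u(t_j)-u(t_{j-1})\|_F$ over all partitions $0=t_0<\dots<t_m=T$, and $\|u\|_{BV,0}:=\|u(0)\|_F+\operatorname{Var}(u;[0,T])$. Elements of $W^{1,1}([0,T];F)$ are identified with their absolutely continuous representatives; $W^{1,1}([0,T];C)$ is the subset of those with values in $C$. $P_C$ is the metric projection onto $C$ in $\|\cdot\|_F$, and $N_C(\sigma)=\{\nu\in F:\langle\nu,z-\sigma\rangle_F\le0\ \forall z\in C\}$ for $\sigma\in C$. History operator: it is a known result (standard sweeping-process theory) that for every $\pi\in W^{1,1}([0,T];F)$ there is a unique $\sigma\in W^{1,1}([0,T];C)$ with $\sigma(0)=P_C(\pi(0))$, $\sigma(t)\in C$ for all $t\in[0,T]$, and $\dot\pi(t)-\dot\sigma(t)\in N_C(\sigma(t))$ for a.e. $t\in(0,T)$. The operator $\mathcal P$ is defined by $\mathcal P(\pi):=\sigma$. *)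

theory Defs
  imports "HOL-Analysis.Analysis" "HOL-Probability.Essential_Supremum"
begin

text \<open>
  Functions on \<open>[0,T]\<close> are total functions on the reals of which only the values on
  \<open>{0..T}\<close> are used.
\<close>

text \<open>The intervals \<open>K\<close> of a division are closed, so \<open>Inf K\<close> and \<open>Sup K\<close> are their end points.\<close>

definition abs_continuous_on_interval :: "real \<Rightarrow> real \<Rightarrow> (real \<Rightarrow> 'a::real_normed_vector) \<Rightarrow> bool"
  where "abs_continuous_on_interval a b u \<longleftrightarrow>
    (\<forall>\<epsilon>>0. \<exists>\<delta>>0. \<forall>D. D division_of \<Union>D \<longrightarrow> \<Union>D \<subseteq> {a..b} \<longrightarrow> (\<Sum>K\<in>D. Sup K - Inf K) < \<delta> \<longrightarrow>
       (\<Sum>K\<in>D. norm (u (Sup K) - u (Inf K))) < \<epsilon>)"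

text \<open>\<open>\<phi>\<close> is a continuously differentiable function with compact support in \<open>(0,T)\<close>, and
  \<open>\<phi>'\<close> is its derivative.\<close>

definition test_function :: "real \<Rightarrow> (real \<Rightarrow> real) \<Rightarrow> (real \<Rightarrow> real) \<Rightarrow> bool"
  where "test_function T \<phi> \<phi>' \<longleftrightarrow>
    (\<forall>t. (\<phi> has_real_derivative \<phi>' t) (at t)) \<and> continuous_on UNIV \<phi>' \<and>
    (\<exists>K. compact K \<and> K \<subseteq> {0<..<T} \<and> (\<forall>t. t \<notin> K \<longrightarrow> \<phi> t = 0))"

definition has_weak_derivative ::
    "real \<Rightarrow> (real \<Rightarrow> 'a::euclidean_space) \<Rightarrow> (real \<Rightarrow> 'a) \<Rightarrow> bool"
  where "has_weak_derivative T u g \<longleftrightarrow>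
    integrable (lebesgue_on {0<..<T}) u \<and> integrable (lebesgue_on {0<..<T}) g \<and>
    (\<forall>\<phi> \<phi>'. test_function T \<phi> \<phi>' \<longrightarrow>
      (LINT t|lebesgue_on {0<..<T}. \<phi>' t *\<^sub>R u t) = - (LINT t|lebesgue_on {0<..<T}. \<phi> t *\<^sub>R g t))"

text \<open>\<open>W11 T C\<close> is the set of absolutely continuous representatives of the elements of
  \<open>W^{1,1}([0,T];C)\<close>; the whole space \<open>W^{1,1}([0,T];F)\<close> is \<open>W11 T UNIV\<close>.\<close>

definition W11 :: "real \<Rightarrow> 'a::euclidean_space set \<Rightarrow> (real \<Rightarrow> 'a) set"
  where "W11 T C = {u. abs_continuous_on_interval 0 T u \<and> (\<exists>g. has_weak_derivative T u g) \<and>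
    (\<forall>t\<in>{0..T}. u t \<in> C)}"

text \<open>Values in \<open>ennreal\<close>, so that the supremum is \<open>\<infinity>\<close> for functions of unbounded variation.\<close>

definition variation :: "real \<Rightarrow> (real \<Rightarrow> 'a::real_normed_vector) \<Rightarrow> ennreal"
  where "variation T u =
    (SUP (m, t) \<in> {(m::nat, t::nat \<Rightarrow> real). t 0 = 0 \<and> t m = T \<and> (\<forall>j\<in>{1..m}. t (j - 1) < t j)}.
       ennreal (\<Sum>j=1..m. norm (u (t j) - u (t (j - 1)))))"

definition bv_norm0 :: "real \<Rightarrow> (real \<Rightarrow> 'a::real_normed_vector) \<Rightarrow> ennreal"
  where "bv_norm0 T u = ennreal (norm (u 0)) + variation T u"

definition Linf_norm :: "real \<Rightarrow> (real \<Rightarrow> 'a::real_normed_vector) \<Rightarrow> ennreal"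
  where "Linf_norm T u = esssup (lebesgue_on {0..T}) (\<lambda>t. ennreal (norm (u t)))"

definition normal_cone :: "'a::real_inner set \<Rightarrow> 'a \<Rightarrow> 'a set"
  where "normal_cone C x = {\<nu>. \<forall>z\<in>C. \<nu> \<bullet> (z - x) \<le> 0}"

text \<open>Weak derivatives are unique almost everywhere, so the choice of \<open>p\<close> and \<open>q\<close> is immaterial.\<close>

definition sweeping_solution ::
    "'a::euclidean_space set \<Rightarrow> real \<Rightarrow> (real \<Rightarrow> 'a) \<Rightarrow> (real \<Rightarrow> 'a) \<Rightarrow> bool"
  where "sweeping_solution C T \<pi> \<sigma> \<longleftrightarrow>
    \<sigma> \<in> W11 T C \<and> \<sigma> 0 = closest_point C (\<pi> 0) \<and>
    (\<exists>p q. has_weak_derivative T \<pi> p \<and> has_weak_derivative T \<sigma> q \<and>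
       (AE t in lebesgue_on {0<..<T}. p t - q t \<in> normal_cone C (\<sigma> t)))"

text \<open>The solution is unique as a function on \<open>[0,T]\<close>; \<open>extensional\<close> fixes its values elsewhere.\<close>

definition history_operator ::
    "'a::euclidean_space set \<Rightarrow> real \<Rightarrow> (real \<Rightarrow> 'a) \<Rightarrow> (real \<Rightarrow> 'a)"
  where "history_operator C T \<pi> = (THE \<sigma>. \<sigma> \<in> extensional {0..T} \<and> sweeping_solution C T \<pi> \<sigma>)"

end

theory Submission
  imports Defs "HOL-Probability.Distribution_Functions"
begin

text \<open>
  On the dyadic grid with \<open>2^n\<close> cells the catching-up scheme
  \<open>x (k + 1) = P_C (x k + \<Delta>\<pi> k)\<close> has all four properties, because \<open>P_C\<close> is nonexpansive
  and fixes the points of \<open>C\<close>. The plastic parts \<open>\<pi> - x\<close> of two schemes whose inputs are uniformly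
  close stay close, by monotonicity of the normal cone and a variation bound; hence the schemes converge
  pointwise as \<open>n \<rightarrow> \<infinity>\<close>. The increments of the limiting plastic part \<open>\<xi>\<close> are dominated by the integral
  of \<open>\<bar>\<pi>'\<bar>\<close>, so \<open>\<xi>\<close> is an integral by Radon--Nikodym, and the discrete variational
  inequalities give \<open>(\<xi> t - \<xi> s) \<bullet> (z - \<sigma> s) \<le> (\<integral> \<bar>\<pi>'\<bar>)\<^sup>2\<close>, the integral being over
  \<open>[s,t]\<close>, for \<open>z \<in> C\<close>. Dividing by \<open>t - s\<close> and letting
  \<open>t \<rightarrow> s\<close> at a Lebesgue point yields the differential inclusion. Solutions are unique, so the
  limit is the history operator and inherits the properties of the schemes.
\<close>

section \<open>The catching-up scheme\<close>

text \<open>The stability estimate cannot show that the grids converge: an input sampled on a coarse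
  grid is uniformly close to its finer sampling, but the variation of the difference need not be
  small. This is why plastic parts are compared instead; their squared distance is controlled by the
  uniform distance alone, times total variations. To share an index set, the coarse scheme is run on
  the fine grid with its input held constant between coarse nodes, where it idles. The scheme is
  implicit, so the normal inequality holds at the new iterate. Testing a whole range of steps at its
  left end costs the length of the plastic path times the length of the path of iterates, both
  bounded by the variation of the input: hence the squared integral, which is of second order and
  survives no division by t - s. All analysis runs through \<open>is_primitive\<close>, to which the
  du Bois-Reymond lemma reduces the weak derivatives of \<open>W11\<close>. Uniqueness has two uses:
  it makes the definite description in \<open>history_operator\<close> denote, and it identifies the
  limit of the schemes with it.\<close>

fun catch_up :: "'a::euclidean_space set \<Rightarrow> (nat \<Rightarrow> 'a) \<Rightarrow> nat \<Rightarrow> 'a" where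
  "catch_up C v 0 = closest_point C (v 0)"
| "catch_up C v (Suc k) = closest_point C (catch_up C v k + (v (Suc k) - v k))"

definition plastic :: "'a::euclidean_space set \<Rightarrow> (nat \<Rightarrow> 'a) \<Rightarrow> nat \<Rightarrow> 'a" where
  "plastic C v k = v k - catch_up C v k"

lemma catch_up_cong:
  assumes "\<And>k. k \<le> n \<Longrightarrow> v k = w k"
  shows "catch_up C v n = catch_up C w n"
  using assms by (induction n) auto

lemma norm_diff_le_sum_increments:
  fixes x :: "nat \<Rightarrow> 'b::real_normed_vector"
  assumes "i \<le> j"
  shows "norm (x j - x i) \<le> (\<Sum>k=i..<j. norm (x (Suc k) - x k))"
  using norm_sum[of "\<lambda>k. x (Suc k) - x k" "{i..<j}"] sum_Suc_diff'[OF assms, of x] by simp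

context
  fixes C :: "'a::euclidean_space set"
  assumes C: "C \<noteq> {}" "closed C" "convex C"
begin

lemma catch_up_in: "catch_up C v k \<in> C"
  using C closest_point_in_set by (cases k) auto

lemma plastic_Suc_diff:
  "plastic C v (Suc k) - plastic C v k =
    (catch_up C v k + (v (Suc k) - v k)) - catch_up C v (Suc k)"
  by (simp add: plastic_def)

text \<open>The increment is the trial point minus its closest point in \<open>C\<close>, so the
  variational characterization of the projection applies. This is the discrete form of the
  differential inclusion.\<close>

lemma plastic_increment_normal:
  assumes "z \<in> C"
  shows "(plastic C v (Suc k) - plastic C v k) \<bullet> (z - catch_up C v (Suc k)) \<le> 0"
  using closest_point_dot[OF C(3,2) assms, of "catch_up C v k + (v (Suc k) - v k)"]
  unfolding plastic_Suc_diff by simp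

text \<open>The previous iterate lies in \<open>C\<close> at distance
  \<open>norm (v (Suc k) - v k)\<close> from the trial point, so the residual of the projection is
  no longer than that.\<close>

lemma norm_plastic_increment: "norm (plastic C v (Suc k) - plastic C v k) \<le> norm (v (Suc k) - v k)"
  using closest_point_le[OF C(2) catch_up_in[of v k], of "catch_up C v k + (v (Suc k) - v k)"]
  unfolding plastic_Suc_diff by (simp add: dist_norm)

lemma norm_catch_up_increment: "norm (catch_up C v (Suc k) - catch_up C v k) \<le> norm (v (Suc k) - v k)"
  using closest_point_lipschitz[OF C(3,2,1), of "catch_up C v k + (v (Suc k) - v k)" "catch_up C v k"]
    closest_point_self[OF catch_up_in[of v k]]
  by (simp add: dist_norm)

lemma catch_up_stability:
  "norm (catch_up C v n - catch_up C w n)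
    \<le> norm (v 0 - w 0) + (\<Sum>k<n. norm ((v (Suc k) - w (Suc k)) - (v k - w k)))"
proof (induction n)
  case 0
  show ?case
    using closest_point_lipschitz[OF C(3,2,1), of "v 0" "w 0"] by (simp add: dist_norm)
next
  case (Suc n)
  have "norm (catch_up C v (Suc n) - catch_up C w (Suc n))
      \<le> norm ((catch_up C v n + (v (Suc n) - v n)) - (catch_up C w n + (w (Suc n) - w n)))"
    using closest_point_lipschitz[OF C(3,2,1), of "catch_up C v n + (v (Suc n) - v n)"
        "catch_up C w n + (w (Suc n) - w n)"] by (simp add: dist_norm)
  also have "\<dots> = norm ((catch_up C v n - catch_up C w n) + ((v (Suc n) - w (Suc n)) - (v n - w n)))"
    by (simp add: algebra_simps)
  also have "\<dots> \<le> norm (catch_up C v n - catch_up C w n) + norm ((v (Suc n) - w (Suc n)) - (v n - w n))"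
    by (rule norm_triangle_ineq)
  finally show ?case using Suc by simp
qed

text \<open>Per step the squared distance of the plastic parts grows by at most twice the pairing of
  the difference of their increments with the difference of the inputs. Only the uniform distance of
  the inputs enters as a small factor; the price is a square root in the resulting rate.\<close>

lemma plastic_comparison:
  assumes "v 0 = w 0" and eps: "\<And>k. k \<le> n \<Longrightarrow> norm (v k - w k) \<le> \<epsilon>"
  shows "(norm (plastic C v n - plastic C w n))\<^sup>2
    \<le> 2 * \<epsilon> * (\<Sum>k<n. norm (v (Suc k) - v k) + norm (w (Suc k) - w k))"
  using eps
proof (induction n)
  case 0
  show ?case using assms(1) by (simp add: plastic_def)
next
  case (Suc n)
  define d where "d = plastic C v n - plastic C w n"
  define d' where "d' = plastic C v (Suc n) - plastic C w (Suc n)"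
  define a where "a = plastic C v (Suc n) - plastic C v n"
  define b where "b = plastic C w (Suc n) - plastic C w n"
  define e where "e = v (Suc n) - w (Suc n)"
  have e: "norm e \<le> \<epsilon>" unfolding e_def using Suc.prems by blast
  have x: "catch_up C w (Suc n) - catch_up C v (Suc n) = d' - e"
    unfolding d'_def e_def by (simp add: plastic_def)
  \<comment> \<open>Each projection inequality is tested with the new iterate of the other scheme;
    their sum is the monotonicity of the normal cone.\<close>
  have "a \<bullet> (d' - e) \<le> 0"
    using plastic_increment_normal[OF catch_up_in, of v n w "Suc n"] unfolding x a_def .
  moreover have "b \<bullet> (- (d' - e)) \<le> 0"
    using plastic_increment_normal[OF catch_up_in, of w n v "Suc n"]
    unfolding x[symmetric] b_def by simp
  ultimately have "(a - b) \<bullet> d' \<le> (a - b) \<bullet> e"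
    by (simp add: inner_diff_left inner_diff_right)
  also have "\<dots> \<le> norm (a - b) * norm e" by (rule norm_cauchy_schwarz)
  also have "\<dots> \<le> (norm a + norm b) * \<epsilon>"
    using e by (intro mult_mono norm_triangle_ineq4) auto
  also have "\<dots> \<le> (norm (v (Suc n) - v n) + norm (w (Suc n) - w n)) * \<epsilon>"
    using norm_plastic_increment[of v n] norm_plastic_increment[of w n] e norm_ge_zero[of e]
    unfolding a_def b_def by (intro mult_right_mono add_mono) linarith+
  finally have *: "(a - b) \<bullet> d' \<le> (norm (v (Suc n) - v n) + norm (w (Suc n) - w n)) * \<epsilon>" .
  have ab: "a - b = d' - d" by (simp add: a_def b_def d_def d'_def)
  \<comment> \<open>Expanding the square of \<open>d' - d\<close> this way pairs the increment with
    the new difference \<open>d'\<close>, for which \<open>*\<close> was derived.\<close>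
  have "(norm d')\<^sup>2 \<le> (norm d)\<^sup>2 + 2 * ((a - b) \<bullet> d')"
    using inner_ge_zero[of "d' - d"] unfolding ab
    by (simp add: power2_norm_eq_inner inner_diff_left inner_diff_right inner_commute)
  with * Suc.IH Suc.prems show ?case
    unfolding d_def d'_def by (simp add: algebra_simps)
qed

text \<open>Each increment is normal at its own new iterate. Replacing that iterate by the one at
  \<open>i\<close> costs the length of the increment times the distance travelled since
  \<open>i\<close>, which is at most the total variation of the input over the range; summation
  gives the square.\<close>

lemma plastic_variational_inequality:
  assumes "i \<le> j" "z \<in> C"
  shows "(plastic C v j - plastic C v i) \<bullet> (z - catch_up C v i)
    \<le> (\<Sum>k=i..<j. norm (v (Suc k) - v k))\<^sup>2"
proof -
  define V where "V = (\<Sum>k=i..<j. norm (v (Suc k) - v k))"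
  let ?d = "\<lambda>k. plastic C v (Suc k) - plastic C v k"
  have step: "?d k \<bullet> (z - catch_up C v i) \<le> norm (v (Suc k) - v k) * V" if k: "k \<in> {i..<j}" for k
  proof -
    have "?d k \<bullet> (z - catch_up C v i)
        = ?d k \<bullet> (z - catch_up C v (Suc k)) + ?d k \<bullet> (catch_up C v (Suc k) - catch_up C v i)"
      by (simp add: inner_add_right[symmetric])
    also have "\<dots> \<le> norm (?d k) * norm (catch_up C v (Suc k) - catch_up C v i)"
      using plastic_increment_normal[OF assms(2), of v k]
        norm_cauchy_schwarz[of "?d k" "catch_up C v (Suc k) - catch_up C v i"] by linarith
    also have "\<dots> \<le> norm (v (Suc k) - v k) * V"
    proof (intro mult_mono norm_plastic_increment)
      have "norm (catch_up C v (Suc k) - catch_up C v i)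
          \<le> (\<Sum>l=i..<Suc k. norm (catch_up C v (Suc l) - catch_up C v l))"
        using k by (intro norm_diff_le_sum_increments) auto
      also have "\<dots> \<le> (\<Sum>l=i..<Suc k. norm (v (Suc l) - v l))"
        by (intro sum_mono norm_catch_up_increment)
      also have "\<dots> \<le> V"
        unfolding V_def using k by (intro sum_mono2) auto
      finally show "norm (catch_up C v (Suc k) - catch_up C v i) \<le> V" .
    qed auto
    finally show ?thesis .
  qed
  have "(plastic C v j - plastic C v i) \<bullet> (z - catch_up C v i)
      = (\<Sum>k=i..<j. ?d k \<bullet> (z - catch_up C v i))"
    by (simp add: sum_Suc_diff'[OF assms(1)] flip: inner_sum_left)
  also have "\<dots> \<le> (\<Sum>k=i..<j. norm (v (Suc k) - v k) * V)"
    by (intro sum_mono step)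
  also have "\<dots> = V\<^sup>2"
    by (simp add: V_def power2_eq_square sum_distrib_right)
  finally show ?thesis unfolding V_def .
qed

text \<open>Off the multiples of \<open>m\<close> the input increment is zero and the projection
  fixes a point that is already in \<open>C\<close>; at the multiples a step of the coarse scheme is
  made. Thus coarse and fine schemes can be compared index by index.\<close>

lemma catch_up_coarse:
  assumes "m > 0"
  shows "catch_up C (\<lambda>k. v (m * (k div m))) k = catch_up C (\<lambda>j. v (m * j)) (k div m)"
proof (induction k)
  case (Suc k)
  show ?case
  proof (cases "Suc k mod m = 0")
    case True
    then have "Suc k div m = Suc (k div m)" by (simp add: div_Suc)
    then show ?thesis using Suc by simp
  next
    case False
    then have *: "Suc k div m = k div m" by (simp add: div_Suc)
    show ?thesis using Suc * closest_point_self[OF catch_up_in] by simp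
  qed
qed simp

end

text \<open>Triangle inequality on consecutive blocks. The indices may repeat, because several
  points of a partition can fall into one dyadic cell; \<open>s 0 \<le> s m\<close> is carried along
  for gluing the index ranges.\<close>

lemma sum_norm_subsequence_le:
  fixes x :: "nat \<Rightarrow> 'b::real_normed_vector" and s :: "nat \<Rightarrow> nat"
  assumes "\<And>j. j < m \<Longrightarrow> s j \<le> s (Suc j)"
  shows "s 0 \<le> s m \<and> (\<Sum>j<m. norm (x (s (Suc j)) - x (s j))) \<le> (\<Sum>k=s 0..<s m. norm (x (Suc k) - x k))"
  using assms
proof (induction m)
  case (Suc m)
  have IH: "s 0 \<le> s m" "(\<Sum>j<m. norm (x (s (Suc j)) - x (s j))) \<le> (\<Sum>k=s 0..<s m. norm (x (Suc k) - x k))"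
    using Suc by auto
  have le: "s m \<le> s (Suc m)" using Suc.prems by blast
  have "(\<Sum>k=s 0..<s m. norm (x (Suc k) - x k)) + (\<Sum>k=s m..<s (Suc m). norm (x (Suc k) - x k))
      = (\<Sum>k=s 0..<s (Suc m). norm (x (Suc k) - x k))"
    by (rule sum.atLeastLessThan_concat[OF IH(1) le])
  then show ?case
    using norm_diff_le_sum_increments[OF le, of x] IH le by simp
qed simp

section \<open>Functions with dominated increments are integrals\<close>

text \<open>A Dynkin argument: half-open intervals form an intersection-stable generator, and
  finite, matching total masses give closure under complements. \<open>N\<close> may live on a
  larger sigma-algebra, as it will be built from \<open>lebesgue\<close>.\<close>

lemma measure_add_eqI_Ioc:
  fixes M1 M2 N :: "real measure"
  assumes fin: "finite_measure M1" "finite_measure M2" "finite_measure N"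
    and sets: "sets M1 = sets borel" "sets M2 = sets borel" "sets borel \<subseteq> sets N"
    and total: "measure M1 UNIV + measure M2 UNIV = measure N UNIV"
    and Ioc: "\<And>a b. a \<le> b \<Longrightarrow> measure M1 {a<..b} + measure M2 {a<..b} = measure N {a<..b}"
    and A: "A \<in> sets borel"
  shows "measure M1 A + measure M2 A = measure N A"
proof -
  interpret M1: finite_measure M1 by fact
  interpret M2: finite_measure M2 by fact
  interpret N: finite_measure N by fact
  let ?G = "range (\<lambda>(a, b). {a<..b::real})"
  have borel: "sets borel = sigma_sets UNIV ?G"
    unfolding borel_sigma_sets_Ioc by (rule sets_measure_of) auto
  have "UNIV \<in> sets N" using sets(3) by auto
  then have "space N = UNIV" "space M1 = UNIV" "space M2 = UNIV"
    using sets sets.sets_into_space[of UNIV N] sets_eq_imp_space_eq[of M1 borel]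
      sets_eq_imp_space_eq[of M2 borel] by auto
  note space = this
  have stable: "Int_stable ?G"
    by (auto simp: Int_stable_def)
  have sub: "?G \<subseteq> Pow UNIV" by simp
  show ?thesis
    using A unfolding borel
  proof (induction rule: sigma_sets_induct_disjoint[OF stable sub, consumes 1, case_names basic empty compl union])
    case (basic X)
    then obtain a b :: real where "X = {a<..b}" by auto
    then show ?case using Ioc[of a b] by (cases "a \<le> b") auto
  next
    case empty show ?case by simp
  next
    case (compl X)
    then have "X \<in> sets borel" unfolding borel by simp
    then have "X \<in> sets M1" "X \<in> sets M2" "X \<in> sets N" using sets by auto
    then show ?case
      using compl total M1.finite_measure_compl[of X] M2.finite_measure_compl[of X] N.finite_measure_compl[of X]
      by (simp add: space)
  next
    case (union X)
    then have "range X \<subseteq> sets borel" unfolding borel by simp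
    then have ran: "range X \<subseteq> sets M1" "range X \<subseteq> sets M2" "range X \<subseteq> sets N" using sets by auto
    have "(\<lambda>i. measure M1 (X i) + measure M2 (X i)) sums (measure M1 (\<Union>i. X i) + measure M2 (\<Union>i. X i))"
      using union(1) ran by (intro sums_add M1.finite_measure_UNION M2.finite_measure_UNION)
    moreover have "(\<lambda>i. measure N (X i)) sums measure N (\<Union>i. X i)"
      using union(1) ran by (intro N.finite_measure_UNION)
    ultimately show ?case using union(3) by (simp add: sums_unique2)
  qed
qed

lemma indefinite_integral_diff:
  fixes g :: "real \<Rightarrow> 'a::euclidean_space"
  assumes "g absolutely_integrable_on {0..T}" "0 \<le> s" "s \<le> t" "t \<le> T"
  shows "integral {0..t} g - integral {0..s} g = integral {s..t} g"
proof -
  have "g integrable_on {0..t}"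
    using assms absolutely_integrable_on_subinterval[OF assms(1), of 0 t]
    by (auto simp: absolutely_integrable_on_def)
  then show ?thesis
    using Henstock_Kurzweil_Integration.integral_combine[of 0 s t g] assms by (simp add: algebra_simps)
qed

text \<open>Both \<open>\<integral>\<rho> + \<xi>\<close> and \<open>\<integral>\<rho> - \<xi>\<close> are increasing, and the two Stieltjes measures add up to \<open>2\<rho>\<close>
  times Lebesgue measure; hence the first one has a density by Radon--Nikodym.\<close>

lemma dominated_increments_imp_integral_real:
  fixes \<xi> \<rho> :: "real \<Rightarrow> real"
  assumes T: "0 \<le> T" and \<rho>: "\<rho> absolutely_integrable_on {0..T}" and \<rho>_nonneg: "\<And>t. 0 \<le> \<rho> t"
    and dom: "\<And>s t. 0 \<le> s \<Longrightarrow> s \<le> t \<Longrightarrow> t \<le> T \<Longrightarrow> \<bar>\<xi> t - \<xi> s\<bar> \<le> integral {s..t} \<rho>"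
  shows "\<exists>r. r absolutely_integrable_on {0..T} \<and> (\<forall>t\<in>{0..T}. \<xi> t - \<xi> 0 = integral {0..t} r)"
proof -
  define R where "R t = integral {0..t} \<rho>" for t
  \<comment> \<open>Clamping to \<open>{0..T}\<close> extends the increasing functions to the whole
    line, constant outside the interval, as \<open>interval_measure\<close> expects.\<close>
  define c where "c x = max 0 (min T x)" for x :: real
  define F where "F x = R (c x) + (\<xi> (c x) - \<xi> 0)" for x
  define G where "G x = R (c x) - (\<xi> (c x) - \<xi> 0)" for x
  have R_diff: "R t - R s = integral {s..t} \<rho>" if "0 \<le> s" "s \<le> t" "t \<le> T" for s t
    unfolding R_def using indefinite_integral_diff[OF \<rho> that] .
  have c_in: "c x \<in> {0..T}" for x using T by (auto simp: c_def)
  have c_mono: "c x \<le> c y" if "x \<le> y" for x y using that by (auto simp: c_def)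
  have c_cont: "continuous_on UNIV c" unfolding c_def by (intro continuous_intros)
  have R_cont: "continuous_on {0..T} R"
    unfolding R_def using \<rho>
    by (intro indefinite_integral_continuous_1) (auto simp: absolutely_integrable_on_def)
  have \<xi>_R: "\<bar>\<xi> t - \<xi> s\<bar> \<le> R t - R s" if "0 \<le> s" "s \<le> t" "t \<le> T" for s t
    using dom[OF that] R_diff[OF that] by simp
  have \<xi>_dist: "dist (\<xi> t) (\<xi> s) \<le> dist (R t) (R s)" if "s \<in> {0..T}" "t \<in> {0..T}" for s t
    using \<xi>_R[of s t] \<xi>_R[of t s] that by (cases "s \<le> t") (auto simp: dist_real_def)
  have \<xi>_cont: "continuous_on {0..T} \<xi>"
    unfolding continuous_on_iff
  proof (intro ballI allI impI)
    fix s e :: real assume s: "s \<in> {0..T}" "0 < e"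
    then obtain d where "d > 0" "\<And>t. t \<in> {0..T} \<Longrightarrow> dist t s < d \<Longrightarrow> dist (R t) (R s) < e"
      using R_cont unfolding continuous_on_iff by blast
    then show "\<exists>d>0. \<forall>t\<in>{0..T}. dist t s < d \<longrightarrow> dist (\<xi> t) (\<xi> s) < e"
      using \<xi>_dist[OF s(1)] by (meson le_less_trans)
  qed
  have "continuous_on UNIV (\<lambda>x. R (c x))" "continuous_on UNIV (\<lambda>x. \<xi> (c x))"
    using continuous_on_compose2[OF R_cont c_cont] continuous_on_compose2[OF \<xi>_cont c_cont] c_in
    by (auto simp: image_subset_iff)
  then have "continuous_on UNIV F" "continuous_on UNIV G"
    unfolding F_def G_def by (auto intro!: continuous_intros)
  then have FG_cont: "continuous (at_right a) F" "continuous (at_right a) G" for a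
    by (auto simp: continuous_on_eq_continuous_at intro: continuous_within_subset)
  have F_mono: "F x \<le> F y" and G_mono: "G x \<le> G y" if "x \<le> y" for x y
    using \<xi>_R[of "c x" "c y"] c_mono[OF that] c_in[of x] c_in[of y]
    unfolding F_def G_def by (auto simp: abs_le_iff)
  have R0: "R 0 = 0" unfolding R_def by simp
  have cases_c: "c x = 0" if "x \<le> 0" for x using that T by (auto simp: c_def)
  have cases_cT: "c x = T" if "T \<le> x" for x using that T by (auto simp: c_def)
  have lims: "(F \<longlongrightarrow> 0) at_bot" "(F \<longlongrightarrow> F T) at_top" "(G \<longlongrightarrow> 0) at_bot" "(G \<longlongrightarrow> G T) at_top"
    using T by (auto intro!: tendsto_eventually eventually_mono[OF eventually_le_at_bot[of "0::real"]]
        eventually_mono[OF eventually_ge_at_top[of T]] simp: F_def G_def cases_c cases_cT R0)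
  have FG0: "F 0 = 0" "G 0 = 0" using cases_c[of 0] by (auto simp: F_def G_def R0)
  have FGT: "0 \<le> F T" "0 \<le> G T" using F_mono[OF T] G_mono[OF T] FG0 by auto
  define M1 where "M1 = interval_measure F"
  define M2 where "M2 = interval_measure G"
  interpret M1: finite_borel_measure M1
    unfolding M1_def using F_mono FG_cont lims FGT by (intro finite_borel_measure_interval_measure) 
  interpret M2: finite_borel_measure M2
    unfolding M2_def using G_mono FG_cont lims FGT by (intro finite_borel_measure_interval_measure) 
  have M_UNIV: "measure M1 UNIV = F T" "measure M2 UNIV = G T"
    unfolding M1_def M2_def measure_def
    using interval_measure_UNIV[OF F_mono FG_cont(1) lims(1,2) FGT(1)]
      interval_measure_UNIV[OF G_mono FG_cont(2) lims(3,4) FGT(2)] FGT by simp_all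
  \<comment> \<open>The factor 2 comes from \<open>F + G = 2 * R\<close>, with \<open>R\<close>
    taken at the clamped point. The density is only Lebesgue measurable, so \<open>N\<close> is
    based on \<open>lebesgue\<close>.\<close>
  define \<rho>' where "\<rho>' x = (if x \<in> {0..T} then 2 * \<rho> x else 0)" for x
  define N where "N = density lebesgue (\<lambda>x. ennreal (\<rho>' x))"
  have "(\<lambda>x. 2 * \<rho> x) absolutely_integrable_on {0..T}"
    using \<rho> by simp
  then have \<rho>'_int: "\<rho>' absolutely_integrable_on UNIV"
    unfolding \<rho>'_def absolutely_integrable_restrict_UNIV .
  then have \<rho>'_meas: "\<rho>' \<in> borel_measurable lebesgue"
    by (auto simp: set_integrable_def)
  have N_emeasure: "emeasure N X = ennreal I" if "(\<rho>' has_integral I) X" "X \<in> sets borel" for I X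
  proof -
    have "emeasure N X = (\<integral>\<^sup>+x. indicator X x * ennreal (\<rho>' x) \<partial>lebesgue)"
      unfolding N_def using that \<rho>'_meas by (subst emeasure_density) (auto simp: mult.commute)
    also have "\<dots> = (\<integral>\<^sup>+x. ennreal (indicator X x * \<rho>' x) \<partial>lebesgue)"
      by (intro nn_integral_cong) (auto simp: indicator_def)
    also have "\<dots> = ennreal I"
      using nn_integral_has_integral_lebesgue[OF _ that(1)] \<rho>_nonneg by (auto simp: \<rho>'_def nn_integral_completion)
    finally show ?thesis .
  qed
  \<comment> \<open>The general \<open>X\<close> covers both half-open intervals and the whole line;
    inside \<open>{0..T}\<close> it differs from \<open>{c a..c b}\<close> by at most the two end
    points.\<close>
  have \<rho>'_has: "(\<rho>' has_integral 2 * (R (c b) - R (c a))) X"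
    if "a \<le> b" "{c a<..<c b} \<subseteq> X" "X \<inter> {0..T} \<subseteq> {c a..c b}" for a b X
  proof -
    have "\<rho> integrable_on {c a..c b}"
      using c_in[of a] c_in[of b] absolutely_integrable_on_subinterval[OF \<rho>, of "c a" "c b"]
      by (auto simp: absolutely_integrable_on_def)
    then have "(\<rho> has_integral (R (c b) - R (c a))) {c a..c b}"
      using R_diff[of "c a" "c b"] c_in[of a] c_in[of b] c_mono[OF that(1)] by (simp add: integrable_integral)
    then have "((\<lambda>x. 2 * \<rho> x) has_integral 2 * (R (c b) - R (c a))) {c a..c b}"
      by (rule has_integral_mult_right)
    then have "((\<lambda>x. 2 * \<rho> x) has_integral 2 * (R (c b) - R (c a))) (X \<inter> {0..T})"
    proof (rule has_integral_spike_set_eq[THEN iffD1, rotated -1])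
      have "{c a..c b} - {c a<..<c b} \<subseteq> {c a, c b}" "{c a..c b} \<subseteq> {0..T}"
        using c_in[of a] c_in[of b] by auto
      then have "{x \<in> {c a..c b} - X \<inter> {0..T}. 2 * \<rho> x \<noteq> 0} \<subseteq> {c a, c b}"
        using that(2) by blast
      then show "negligible {x \<in> {c a..c b} - X \<inter> {0..T}. 2 * \<rho> x \<noteq> 0}"
        by (rule negligible_subset[rotated]) simp
      show "negligible {x \<in> X \<inter> {0..T} - {c a..c b}. 2 * \<rho> x \<noteq> 0}"
        by (rule negligible_subset[OF negligible_empty]) (use that(3) in auto)
    qed
    then show ?thesis
      unfolding \<rho>'_def using has_integral_restrict_Int[of "{0..T}" "\<lambda>x. 2 * \<rho> x" _ X] by (simp add: Int_commute)
  qed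
  have N_Ioc: "emeasure N {a<..b} = ennreal (2 * (R (c b) - R (c a)))" if "a \<le> b" for a b
    using T by (intro N_emeasure \<rho>'_has that) (auto simp: c_def)
  have N_UNIV: "emeasure N UNIV = ennreal (2 * R T)"
    using N_emeasure[OF \<rho>'_has[of 0 T UNIV]] T cases_c[of 0] cases_cT[of T] R0 by auto
  have N_fin: "finite_measure N"
    by standard (use N_UNIV in \<open>simp add: N_def\<close>)
  have M_le_N: "measure M1 A + measure M2 A = measure N A" if "A \<in> sets borel" for A
  proof (rule measure_add_eqI_Ioc[OF _ _ N_fin _ _ _ _ _ that])
    show "sets borel \<subseteq> sets N" by (auto simp: N_def)
    show "measure M1 UNIV + measure M2 UNIV = measure N UNIV"
      using N_UNIV R_diff[of 0 T] FGT M_UNIV cases_cT[of T]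
      by (simp add: measure_def[of N] F_def G_def)
    show "measure M1 {a<..b} + measure M2 {a<..b} = measure N {a<..b}" if "a \<le> b" for a b
    proof -
      have "measure M1 {a<..b} = F b - F a" "measure M2 {a<..b} = G b - G a"
        unfolding M1_def M2_def
        using measure_interval_measure_Ioc[OF that F_mono] measure_interval_measure_Ioc[OF that G_mono] FG_cont by auto
      moreover have "measure N {a<..b} = 2 * (R (c b) - R (c a))"
        using N_Ioc[OF that] F_mono[OF that] G_mono[OF that] by (simp add: measure_def F_def G_def)
      ultimately show ?thesis by (simp add: F_def G_def)
    qed
  qed (auto simp: M1_def M2_def M1.finite_measure_axioms[unfolded M1_def] M2.finite_measure_axioms[unfolded M2_def])
  interpret N: finite_measure N by fact
  \<comment> \<open>A Lebesgue null set has \<open>N\<close>-measure zero, and two nonnegative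
    masses that add up to zero both vanish.\<close>
  have ac: "Radon_Nikodym.absolutely_continuous lborel M1"
    unfolding absolutely_continuous_def
  proof
    fix X :: "real set" assume X: "X \<in> null_sets lborel"
    then have "X \<in> null_sets lebesgue" by (simp add: null_sets_completionI)
    then have "X \<in> null_sets N"
      unfolding N_def using absolutely_continuousI_density[of "\<lambda>x. ennreal (\<rho>' x)" lebesgue] \<rho>'_meas
      by (auto simp: absolutely_continuous_def)
    then have "measure M1 X + measure M2 X = 0"
      using M_le_N[of X] X by (simp add: null_sets_def measure_def)
    then have "measure M1 X = 0"
      using measure_nonneg[of M1 X] measure_nonneg[of M2 X] by linarith
    then show "X \<in> null_sets M1"
      using X M1.emeasure_eq_measure[of X] by (auto simp: null_sets_def M1_def)
  qed
  then obtain f where f: "f \<in> borel_measurable lborel" "density lborel f = M1"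
    using sigma_finite_measure.Radon_Nikodym[OF sigma_finite_lborel ac] by (auto simp: M1_def)
  have f_em: "(\<integral>\<^sup>+x. f x * indicator X x \<partial>lborel) = emeasure M1 X" if "X \<in> sets borel" for X
    using emeasure_density[OF f(1), of X] f(2) that by simp
  have "(\<integral>\<^sup>+x. f x \<partial>lborel) \<noteq> \<infinity>"
    using f_em[of UNIV] M1.emeasure_eq_measure[of UNIV] by simp
  then have f_fin: "AE x in lborel. f x \<noteq> \<infinity>"
    using nn_integral_noteq_infinite[of f lborel] f(1) by simp
  define r1 where "r1 x = enn2real (f x)" for x
  have r1_meas: "r1 \<in> borel_measurable lborel" unfolding r1_def using f(1) by measurable
  have r1_em: "(\<integral>\<^sup>+x. ennreal (r1 x * indicator X x) \<partial>lborel) = ennreal (measure M1 X)" if "X \<in> sets borel" for X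
  proof -
    have "(\<integral>\<^sup>+x. ennreal (r1 x * indicator X x) \<partial>lborel) = (\<integral>\<^sup>+x. f x * indicator X x \<partial>lborel)"
      using f_fin by (intro nn_integral_cong_AE)
        (auto elim!: eventually_mono simp: r1_def indicator_def less_top)
    then show ?thesis using f_em[OF that] M1.emeasure_eq_measure by simp
  qed
  have r1_int: "integrable lborel r1"
    using r1_em[of UNIV] r1_meas by (intro integrableI_bounded) (auto simp: r1_def)
  have r1_val: "integral {0..t} r1 = F t" if "t \<in> {0..T}" for t
  proof -
    have "set_integrable lborel {0<..t} r1"
      using r1_int unfolding set_integrable_def by (intro integrable_mult_indicator) auto
    then have "integral {0<..t} r1 = (LBINT x:{0<..t}. r1 x)"
      using set_borel_integral_eq_integral(2) by metis
    also have "\<dots> = enn2real (\<integral>\<^sup>+x. ennreal (r1 x * indicator {0<..t} x) \<partial>lborel)"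
      unfolding set_lebesgue_integral_def using f(1)
      by (subst integral_eq_nn_integral) (auto simp: r1_def mult.commute)
    also have "\<dots> = measure M1 {0<..t}" by (simp add: r1_em)
    also have "\<dots> = F t"
      unfolding M1_def using that measure_interval_measure_Ioc[of 0 t F] F_mono FG_cont FG0 by auto
    also have "integral {0<..t} r1 = integral {0..t} r1"
      by (rule integral_spike_set; rule negligible_subset[of "{0}"]) auto
    finally show ?thesis .
  qed
  have "integrable lebesgue r1" using r1_int by (simp add: integrable_completion)
  then have r1_abs: "r1 absolutely_integrable_on {0..T}"
    unfolding set_integrable_def by (intro integrable_mult_indicator) auto
  show ?thesis
  \<comment> \<open>\<open>r1\<close> is the density of the measure of \<open>F\<close>, and on the
    interval \<open>F\<close> is \<open>R\<close> plus the increment of \<xi>; subtracting \<rho>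
    removes \<open>R\<close>.\<close>
  proof (intro exI[of _ "\<lambda>x. r1 x - \<rho> x"] conjI ballI)
    show "(\<lambda>x. r1 x - \<rho> x) absolutely_integrable_on {0..T}"
      using r1_abs \<rho> by (rule set_integral_diff)
    fix t assume t: "t \<in> {0..T}"
    have "r1 integrable_on {0..t}" "\<rho> integrable_on {0..t}"
      using t absolutely_integrable_on_subinterval[OF r1_abs, of 0 t]
        absolutely_integrable_on_subinterval[OF \<rho>, of 0 t]
      by (auto simp: absolutely_integrable_on_def)
    then have "integral {0..t} (\<lambda>x. r1 x - \<rho> x) = F t - R t"
      by (simp add: Henstock_Kurzweil_Integration.integral_diff r1_val[OF t] R_def)
    moreover have "c t = t" using t by (auto simp: c_def)
    ultimately show "\<xi> t - \<xi> 0 = integral {0..t} (\<lambda>x. r1 x - \<rho> x)"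
      by (simp add: F_def)
  qed
qed

lemma dominated_increments_imp_integral:
  fixes \<xi> :: "real \<Rightarrow> 'a::euclidean_space" and \<rho> :: "real \<Rightarrow> real"
  assumes T: "0 \<le> T" and \<rho>: "\<rho> absolutely_integrable_on {0..T}" "\<And>t. 0 \<le> \<rho> t"
    and dom: "\<And>s t. 0 \<le> s \<Longrightarrow> s \<le> t \<Longrightarrow> t \<le> T \<Longrightarrow> norm (\<xi> t - \<xi> s) \<le> integral {s..t} \<rho>"
  shows "\<exists>r. r absolutely_integrable_on {0..T} \<and> (\<forall>t\<in>{0..T}. \<xi> t - \<xi> 0 = integral {0..t} r)"
proof -
  have "\<forall>i\<in>Basis. \<exists>r. r absolutely_integrable_on {0..T} \<and>
      (\<forall>t\<in>{0..T}. \<xi> t \<bullet> i - \<xi> 0 \<bullet> i = integral {0..t} r)"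
  proof
    fix i :: 'a assume i: "i \<in> Basis"
    show "\<exists>r. r absolutely_integrable_on {0..T} \<and> (\<forall>t\<in>{0..T}. \<xi> t \<bullet> i - \<xi> 0 \<bullet> i = integral {0..t} r)"
    proof (rule dominated_increments_imp_integral_real[OF T \<rho>])
      fix s t :: real assume st: "0 \<le> s" "s \<le> t" "t \<le> T"
      show "\<bar>\<xi> t \<bullet> i - \<xi> s \<bullet> i\<bar> \<le> integral {s..t} \<rho>"
        using order_trans[OF Basis_le_norm[OF i] dom[OF st]] by (simp add: inner_diff_left)
    qed
  qed
  then obtain r where r: "\<And>i. i \<in> Basis \<Longrightarrow> r i absolutely_integrable_on {0..T}"
      "\<And>i t. i \<in> Basis \<Longrightarrow> t \<in> {0..T} \<Longrightarrow> \<xi> t \<bullet> i - \<xi> 0 \<bullet> i = integral {0..t} (r i)"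
    by metis
  let ?r = "\<lambda>x. \<Sum>i\<in>Basis. r i x *\<^sub>R i"
  show ?thesis
  proof (intro exI[of _ ?r] conjI ballI)
    show "?r absolutely_integrable_on {0..T}"
      by (intro absolutely_integrable_sum absolutely_integrable_scaleR_right r) auto
    fix t assume t: "t \<in> {0..T}"
    have int: "r i integrable_on {0..t}" if "i \<in> Basis" for i
      using t absolutely_integrable_on_subinterval[OF r(1)[OF that], of 0 t]
      by (auto simp: absolutely_integrable_on_def)
    have "(?r has_integral (\<Sum>i\<in>Basis. integral {0..t} (r i) *\<^sub>R i)) {0..t}"
      by (intro has_integral_sum has_integral_scaleR_left integrable_integral int) auto
    then have "integral {0..t} ?r = (\<Sum>i\<in>Basis. (\<xi> t \<bullet> i - \<xi> 0 \<bullet> i) *\<^sub>R i)"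
      using r(2)[OF _ t] by (simp add: integral_unique)
    also have "\<dots> = \<xi> t - \<xi> 0"
      using euclidean_representation[of "\<xi> t - \<xi> 0"] by (simp add: inner_diff_left)
    finally show "\<xi> t - \<xi> 0 = integral {0..t} ?r" by simp
  qed
qed

section \<open>Absolutely continuous functions and weak derivatives\<close>

text \<open>The working form of \<open>W11\<close>: for \<open>0 < T\<close> it is shown below to be
  equivalent to absolute continuity of \<open>u\<close> together with \<open>g\<close> being a weak
  derivative of \<open>u\<close>.\<close>

definition is_primitive :: "real \<Rightarrow> (real \<Rightarrow> 'a::euclidean_space) \<Rightarrow> (real \<Rightarrow> 'a) \<Rightarrow> bool" where
  "is_primitive T u g \<longleftrightarrow> g absolutely_integrable_on {0..T} \<and>
    (\<forall>t\<in>{0..T}. u t - u 0 = integral {0..t} g)"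

lemma absolutely_integrable_on_subinterval_0T:
  fixes g :: "real \<Rightarrow> 'a::euclidean_space"
  assumes "g absolutely_integrable_on {0..T}" "0 \<le> s" "t \<le> T"
  shows "g integrable_on {s..t}" "(\<lambda>x. norm (g x)) integrable_on {s..t}"
  using absolutely_integrable_on_subinterval[OF assms(1), of s t] assms
  by (auto simp: absolutely_integrable_on_def)

lemma is_primitive_diff:
  assumes "is_primitive T u g" "0 \<le> s" "s \<le> t" "t \<le> T"
  shows "u t - u s = integral {s..t} g"
proof -
  have "u t - u 0 = integral {0..t} g" "u s - u 0 = integral {0..s} g"
    using assms unfolding is_primitive_def by auto
  then have "u t - u s = integral {0..t} g - integral {0..s} g"
    by (simp add: algebra_simps)
  then show ?thesis
    using indefinite_integral_diff[where g = g and T = T and s = s and t = t] assms by (simp add: is_primitive_def)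
qed

lemma is_primitive_norm_diff:
  assumes "is_primitive T u g" "0 \<le> s" "s \<le> t" "t \<le> T"
  shows "norm (u t - u s) \<le> integral {s..t} (\<lambda>x. norm (g x))"
  using assms absolutely_integrable_on_subinterval_0T[where g = g and T = T and s = s and t = t]
  unfolding is_primitive_diff[OF assms]
  by (intro integral_norm_bound_integral) (auto simp: is_primitive_def)

lemma is_primitive_continuous:
  assumes "is_primitive T u g"
  shows "continuous_on {0..T} u"
proof -
  have "continuous_on {0..T} (\<lambda>t. u 0 + integral {0..t} g)"
    using assms unfolding is_primitive_def
    by (intro continuous_intros indefinite_integral_continuous_1) (auto simp: absolutely_integrable_on_def)
  moreover have "u 0 + integral {0..t} g = u t" if "t \<in> {0..T}" for t
    using assms that unfolding is_primitive_def by (metis add_diff_cancel_left' diff_add_cancel add.commute)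
  ultimately show ?thesis by (rule continuous_on_eq)
qed

lemma is_primitive_cong:
  assumes "is_primitive T u g" "0 \<le> T" "\<And>t. t \<in> {0..T} \<Longrightarrow> v t = u t"
  shows "is_primitive T v g"
  using assms unfolding is_primitive_def by auto

lemma is_primitive_minus:
  assumes "is_primitive T u g" "is_primitive T v h"
  shows "is_primitive T (\<lambda>t. u t - v t) (\<lambda>t. g t - h t)"
proof -
  have abs: "g absolutely_integrable_on {0..T}" "h absolutely_integrable_on {0..T}"
    using assms by (auto simp: is_primitive_def)
  have "(u t - v t) - (u 0 - v 0) = integral {0..t} (\<lambda>t. g t - h t)" if "t \<in> {0..T}" for t
  proof -
    have "u t - u 0 = integral {0..t} g" "v t - v 0 = integral {0..t} h"
      using assms that by (auto simp: is_primitive_def)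
    moreover have "integral {0..t} (\<lambda>t. g t - h t) = integral {0..t} g - integral {0..t} h"
      using abs that
      by (intro Henstock_Kurzweil_Integration.integral_diff absolutely_integrable_on_subinterval_0T[where T = T]) auto
    ultimately show ?thesis by (simp add: algebra_simps)
  qed
  then show ?thesis
    using abs by (auto simp: is_primitive_def intro: set_integral_diff)
qed

text \<open>The excess over height \<open>n\<close> is eventually zero at each point and dominated
  by \<open>f\<close>, so dominated convergence applies. It yields the uniform integrability behind
  absolute continuity.\<close>

lemma absolutely_integrable_truncation:
  fixes f :: "real \<Rightarrow> real"
  assumes f: "f absolutely_integrable_on {a..b}" "\<And>x. 0 \<le> f x" and "\<epsilon> > 0"
  shows "\<exists>n::nat. (\<lambda>x. min (f x) n) integrable_on {a..b} \<and>
    integral {a..b} (\<lambda>x. f x - min (f x) n) < \<epsilon>"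
proof -
  have int: "(\<lambda>x. min (f x) (real n)) absolutely_integrable_on {a..b}" for n :: nat
    using f(1) by (intro absolutely_integrable_min_1 absolutely_integrable_on_const) auto
  have int': "(\<lambda>x. f x - min (f x) (real n)) integrable_on {a..b}" for n
    using f(1) int by (intro integrable_diff) (auto simp: absolutely_integrable_on_def)
  have "(\<lambda>n. integral {a..b} (\<lambda>x. f x - min (f x) (real n))) \<longlonglongrightarrow> integral {a..b} (\<lambda>x. 0)"
  proof (rule dominated_convergence(2)[where h = f])
    fix x assume "x \<in> {a..b}"
    have "f x - min (f x) (real n) = 0" if "n \<ge> nat \<lceil>f x\<rceil>" for n
      using that by linarith
    then show "(\<lambda>n. f x - min (f x) (real n)) \<longlonglongrightarrow> 0"
      by (intro tendsto_eventually) (auto simp: eventually_sequentially intro!: exI[of _ "nat \<lceil>f x\<rceil>"])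
  qed (use f int' in \<open>auto simp: absolutely_integrable_on_def\<close>)
  then have "\<forall>\<^sub>F n in sequentially. integral {a..b} (\<lambda>x. f x - min (f x) (real n)) < \<epsilon>"
    using \<open>\<epsilon> > 0\<close> by (intro order_tendstoD(2)) simp_all
  then show ?thesis
    using int by (auto simp: eventually_sequentially absolutely_integrable_on_def)
qed

lemma is_primitive_imp_abs_continuous:
  assumes u: "is_primitive T u g"
  shows "abs_continuous_on_interval 0 T u"
  unfolding abs_continuous_on_interval_def
proof (intro allI impI)
  fix \<epsilon> :: real assume "\<epsilon> > 0"
  \<comment> \<open>Split \<open>norm (g x)\<close> at a height \<open>n\<close> above which it has small integral.\<close>
  let ?f = "\<lambda>x. norm (g x)"
  have "?f absolutely_integrable_on {0..T}"
    using u by (auto simp: is_primitive_def intro: set_integrable_norm)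
  note f = this
  obtain n :: nat where n: "(\<lambda>x. min (?f x) n) integrable_on {0..T}"
      "integral {0..T} (\<lambda>x. ?f x - min (?f x) n) < \<epsilon> / 2"
    using absolutely_integrable_truncation[OF f] \<open>\<epsilon> > 0\<close> by (meson half_gt_zero norm_ge_zero)
  define h where "h x = ?f x - min (?f x) n" for x
  have h_int: "h integrable_on {0..T}"
    unfolding h_def using n(1) f by (intro integrable_diff) (auto simp: absolutely_integrable_on_def)
  have h_nonneg: "0 \<le> h x" for x by (simp add: h_def)
  \<comment> \<open>This is the \<delta> for which the bounded part contributes less than half of
    \<epsilon>; \<open>n + 1\<close> avoids a zero denominator.\<close>
  have n_pos: "0 < \<epsilon> / (2 * (real n + 1))" using \<open>\<epsilon> > 0\<close> by simp
  show "\<exists>\<delta>>0. \<forall>D. D division_of \<Union>D \<longrightarrow> \<Union>D \<subseteq> {0..T} \<longrightarrow> (\<Sum>K\<in>D. Sup K - Inf K) < \<delta> \<longrightarrow>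
       (\<Sum>K\<in>D. norm (u (Sup K) - u (Inf K))) < \<epsilon>"
  proof (rule exI, rule conjI[OF n_pos], intro allI impI)
    fix D assume D: "D division_of \<Union>D" and DT: "\<Union>D \<subseteq> {0..T}"
      and small: "(\<Sum>K\<in>D. Sup K - Inf K) < \<epsilon> / (2 * (real n + 1))"
    have K: "K = {Inf K..Sup K} \<and> Inf K \<le> Sup K \<and> 0 \<le> Inf K \<and> Sup K \<le> T" if K: "K \<in> D" for K
    proof -
      obtain a b where ab: "K = {a..b}" using division_ofD(4)[OF D K] by auto
      with division_ofD(3)[OF D K] have "a \<le> b" by auto
      moreover have "K \<subseteq> {0..T}" using DT K by blast
      ultimately show ?thesis using ab by auto
    qed
    have each: "norm (u (Sup K) - u (Inf K)) \<le> n * (Sup K - Inf K) + integral K h" if "K \<in> D" for K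
    proof -
      have sub: "{Inf K..Sup K} \<subseteq> {0..T}"
        using K[OF that] unfolding atLeastatMost_subset_iff by blast
      have "norm (u (Sup K) - u (Inf K)) \<le> integral {Inf K..Sup K} ?f"
        using K[OF that] by (intro is_primitive_norm_diff[OF u]) auto
      also have "\<dots> \<le> integral {Inf K..Sup K} (\<lambda>x. real n + h x)"
        using K[OF that] f u sub
        by (intro integral_le integrable_add integrable_const_ivl
              absolutely_integrable_on_subinterval_0T[where T = T and g = g]
              integrable_subinterval_real[OF h_int]) (auto simp: h_def is_primitive_def)
      also have "\<dots> = n * (Sup K - Inf K) + integral {Inf K..Sup K} h"
        using conjunct1[OF conjunct2[OF K[OF that]]] integrable_subinterval_real[OF h_int sub]
        by (subst Henstock_Kurzweil_Integration.integral_add) auto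
      finally show ?thesis using conjunct1[OF K[OF that]] by metis
    qed
    have "(\<Sum>K\<in>D. norm (u (Sup K) - u (Inf K))) \<le> n * (\<Sum>K\<in>D. Sup K - Inf K) + (\<Sum>K\<in>D. integral K h)"
      using sum_mono[OF each, of D "\<lambda>K. K"] by (simp add: sum.distrib sum_distrib_left)
    also have "(\<Sum>K\<in>D. integral K h) = integral (\<Union>D) h"
      using D h_int DT
      by (intro integral_combine_division_topdown[symmetric] integrable_on_subdivision[OF D h_int]) auto
    also have "integral (\<Union>D) h \<le> integral {0..T} h"
      using D h_int DT h_nonneg
      by (intro integral_subset_le integrable_on_subdivision[OF D h_int]) auto
    also have "n * (\<Sum>K\<in>D. Sup K - Inf K) \<le> n * (\<epsilon> / (2 * (real n + 1)))"
      using small by (intro mult_left_mono) auto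
    also have "n * (\<epsilon> / (2 * (real n + 1))) < \<epsilon> / 2"
      using \<open>\<epsilon> > 0\<close> by (simp add: field_simps)
    finally show "(\<Sum>K\<in>D. norm (u (Sup K) - u (Inf K))) < \<epsilon>"
      using n(2) by (simp add: h_def)
  qed
qed

text \<open>On a uniform partition of mesh below \<delta> the bounds telescope to
  \<open>\<epsilon> * (R T - R 0)\<close>, and \<epsilon> is arbitrary. This proves identities
  between primitives without pointwise differentiation.\<close>

lemma constant_if_increments_small:
  fixes H :: "real \<Rightarrow> 'a::real_normed_vector"
  assumes T: "0 \<le> T"
    and small: "\<And>\<epsilon>. \<epsilon> > 0 \<Longrightarrow> \<exists>\<delta>>0. \<forall>s t. 0 \<le> s \<longrightarrow> s \<le> t \<longrightarrow> t \<le> T \<longrightarrow> t - s < \<delta> \<longrightarrow>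
      norm (H t - H s) \<le> \<epsilon> * (R t - R s)"
  shows "H T = H 0"
proof -
  have bound: "norm (H T - H 0) \<le> \<epsilon> * (R T - R 0)" if eps: "\<epsilon> > 0" for \<epsilon>
  proof -
    obtain \<delta> where \<delta>: "\<delta> > 0" "\<And>s t. 0 \<le> s \<Longrightarrow> s \<le> t \<Longrightarrow> t \<le> T \<Longrightarrow> t - s < \<delta> \<Longrightarrow>
        norm (H t - H s) \<le> \<epsilon> * (R t - R s)"
      using small[OF eps] by blast
    obtain N :: nat where N: "T / \<delta> < real N" using reals_Archimedean2 by blast
    then have N0: "N > 0" using T \<delta>(1) by (cases N) (auto simp: field_simps)
    define s where "s k = real k * T / real N" for k :: nat
    have step: "norm (H (s (Suc k)) - H (s k)) \<le> \<epsilon> * (R (s (Suc k)) - R (s k))" if "k < N" for k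
    proof (rule \<delta>(2))
      show "0 \<le> s k" using T by (simp add: s_def)
      show "s k \<le> s (Suc k)" using T by (auto simp: s_def intro!: divide_right_mono mult_right_mono)
      have "real (Suc k) * T \<le> real N * T"
        using that T by (intro mult_right_mono) auto
      then show "s (Suc k) \<le> T" using N0 by (simp add: s_def field_simps)
      have "s (Suc k) - s k = T / real N" by (simp add: s_def add_divide_distrib ring_distribs)
      moreover have "T / real N < \<delta>" using N N0 \<delta>(1) by (simp add: field_simps)
      ultimately show "s (Suc k) - s k < \<delta>" by simp
    qed
    have "norm (H (s N) - H (s 0)) \<le> (\<Sum>k<N. norm (H (s (Suc k)) - H (s k)))"
      using norm_sum[of "\<lambda>k. H (s (Suc k)) - H (s k)" "{..<N}"]
        sum_lessThan_telescope[of "\<lambda>k. H (s k)" N] by simp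
    also have "\<dots> \<le> (\<Sum>k<N. \<epsilon> * (R (s (Suc k)) - R (s k)))"
      by (intro sum_mono step) simp
    also have "\<dots> = \<epsilon> * (R (s N) - R (s 0))"
      using sum_lessThan_telescope[of "\<lambda>k. R (s k)" N] by (simp flip: sum_distrib_left)
    finally show ?thesis using N0 by (simp add: s_def)
  qed
  have "norm (H T - H 0) \<le> 0"
  proof (rule field_le_epsilon)
    fix e :: real assume "e > 0"
    let ?r = "\<bar>R T - R 0\<bar> + 1"
    have "norm (H T - H 0) \<le> (e / ?r) * (R T - R 0)"
      using \<open>e > 0\<close> by (intro bound) simp
    also have "\<dots> \<le> (e / ?r) * ?r"
      using \<open>e > 0\<close> by (intro mult_left_mono) auto
    also have "\<dots> = e" by simp
    finally show "norm (H T - H 0) \<le> 0 + e" by simp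
  qed
  then show ?thesis by simp
qed

lemma absolutely_integrable_bilinear_continuous:
  fixes B :: "'a::euclidean_space \<Rightarrow> 'b::euclidean_space \<Rightarrow> 'c::euclidean_space"
  assumes B: "bounded_bilinear B" and u: "continuous_on {a..b::real} u" and g: "g absolutely_integrable_on {a..b}"
  shows "(\<lambda>t. B (u t) (g t)) absolutely_integrable_on {a..b}"
proof (rule absolutely_integrable_bounded_measurable_product[where h = B and f = u, OF _ _ _ _ g])
  show "bilinear B" using B by (simp add: bilinear_conv_bounded_bilinear)
  show "bounded (u ` {a..b})" using compact_continuous_image[OF u] compact_imp_bounded by blast
  show "u \<in> borel_measurable (lebesgue_on {a..b})"
    using continuous_imp_measurable_on_sets_lebesgue[OF u] by simp
qed simp

text \<open>The Leibniz rule, used with scalar multiplication for integration by parts and with the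
  inner product for the energy estimate. Over a short interval the defect is an integral of
  \<open>g\<close> and \<open>h\<close> against oscillations of \<open>v\<close> and
  \<open>u\<close>, which uniform continuity makes small.\<close>

lemma is_primitive_bilinear:
  fixes B :: "'a::euclidean_space \<Rightarrow> 'b::euclidean_space \<Rightarrow> 'c::euclidean_space"
  assumes B: "bounded_bilinear B" and u: "is_primitive T u g" and v: "is_primitive T v h"
  shows "is_primitive T (\<lambda>t. B (u t) (v t)) (\<lambda>t. B (g t) (v t) + B (u t) (h t))"
proof -
  interpret bounded_bilinear B by fact
  have g: "g absolutely_integrable_on {0..T}" and h: "h absolutely_integrable_on {0..T}"
    using u v by (auto simp: is_primitive_def)
  have cu: "continuous_on {0..T} u" and cv: "continuous_on {0..T} v"
    using u v is_primitive_continuous by blast+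
  have abs1: "(\<lambda>t. B (g t) (v t)) absolutely_integrable_on {0..T}"
    using absolutely_integrable_bilinear_continuous[OF flip cv g] .
  have abs2: "(\<lambda>t. B (u t) (h t)) absolutely_integrable_on {0..T}"
    using absolutely_integrable_bilinear_continuous[OF B cu h] .
  define F where "F t = B (g t) (v t) + B (u t) (h t)" for t
  have F: "F absolutely_integrable_on {0..T}"
    unfolding F_def using abs1 abs2 by (rule set_integral_add)
  obtain K where K: "K > 0" "\<And>x y. norm (B x y) \<le> norm x * norm y * K"
    using pos_bounded by blast
  define R where "R t = integral {0..t} (\<lambda>x. norm (g x) + norm (h x))" for t
  have gh: "(\<lambda>x. norm (g x) + norm (h x)) absolutely_integrable_on {0..T}"
    using g h by (intro set_integral_add set_integrable_norm)
  have key: "B (u t) (v t) - integral {0..t} F = B (u 0) (v 0) - integral {0..0} F" if t: "t \<in> {0..T}" for t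
  proof (rule constant_if_increments_small[where R = R])
    show "0 \<le> t" using t by simp
    fix \<epsilon> :: real assume "\<epsilon> > 0"
    then have e: "\<epsilon> / K > 0" using K by simp
    have "uniformly_continuous_on {0..T} u" "uniformly_continuous_on {0..T} v"
      using cu cv by (auto intro: compact_uniformly_continuous)
    then obtain d1 d2 where d1: "d1 > 0" "\<And>x y. x \<in> {0..T} \<Longrightarrow> y \<in> {0..T} \<Longrightarrow> dist y x < d1 \<Longrightarrow> dist (u y) (u x) < \<epsilon> / K"
      and d2: "d2 > 0" "\<And>x y. x \<in> {0..T} \<Longrightarrow> y \<in> {0..T} \<Longrightarrow> dist y x < d2 \<Longrightarrow> dist (v y) (v x) < \<epsilon> / K"
      using e unfolding uniformly_continuous_on_def by metis
    show "\<exists>\<delta>>0. \<forall>a b. 0 \<le> a \<longrightarrow> a \<le> b \<longrightarrow> b \<le> t \<longrightarrow> b - a < \<delta> \<longrightarrow>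
      norm ((B (u b) (v b) - integral {0..b} F) - (B (u a) (v a) - integral {0..a} F)) \<le> \<epsilon> * (R b - R a)"
    proof (intro exI[of _ "min d1 d2"] conjI allI impI)
      fix a b assume ab: "0 \<le> a" "a \<le> b" "b \<le> t" "b - a < min d1 d2"
      then have bT: "b \<le> T" using t by simp
      have I: "integral {0..b} F - integral {0..a} F = integral {a..b} F"
        using indefinite_integral_diff[OF F] ab bT by simp
      have gI: "g integrable_on {a..b}" and hI: "h integrable_on {a..b}" and FI: "F integrable_on {a..b}"
        and ghI: "(\<lambda>x. norm (g x) + norm (h x)) integrable_on {a..b}"
        using absolutely_integrable_on_subinterval_0T(1)[OF _ ab(1) bT] g h F gh by blast+
      \<comment> \<open>Freezing \<open>v\<close> at the right end and \<open>u\<close> at the left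
        end makes the two integrals add up exactly to
        \<open>B (u b) (v b) - B (u a) (v a)\<close>.\<close>
      have "((\<lambda>x. B (g x) (v b)) has_integral B (integral {a..b} g) (v b)) {a..b}"
        using has_integral_linear[OF integrable_integral[OF gI] bounded_linear_left[of "v b"]] by (simp add: o_def)
      moreover have "((\<lambda>x. B (u a) (h x)) has_integral B (u a) (integral {a..b} h)) {a..b}"
        using has_integral_linear[OF integrable_integral[OF hI] bounded_linear_right[of "u a"]] by (simp add: o_def)
      ultimately have "((\<lambda>x. B (g x) (v b) + B (u a) (h x) - F x) has_integral
          B (u b - u a) (v b) + B (u a) (v b - v a) - integral {a..b} F) {a..b}"
        unfolding is_primitive_diff[OF u ab(1,2) bT] is_primitive_diff[OF v ab(1,2) bT]
        using integrable_integral[OF FI] by (intro has_integral_diff has_integral_add)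
      also have "B (u b - u a) (v b) + B (u a) (v b - v a) = B (u b) (v b) - B (u a) (v a)"
        by (simp add: diff_left diff_right)
      also have "(\<lambda>x. B (g x) (v b) + B (u a) (h x) - F x) = (\<lambda>x. B (g x) (v b - v x) + B (u a - u x) (h x))"
        by (simp add: F_def diff_left diff_right fun_eq_iff)
      finally have *: "((\<lambda>x. B (g x) (v b - v x) + B (u a - u x) (h x)) has_integral
          B (u b) (v b) - B (u a) (v a) - integral {a..b} F) {a..b}" .
      have "norm (integral {a..b} (\<lambda>x. B (g x) (v b - v x) + B (u a - u x) (h x)))
          \<le> integral {a..b} (\<lambda>x. \<epsilon> * (norm (g x) + norm (h x)))"
      proof (rule integral_norm_bound_integral)
        show "(\<lambda>x. B (g x) (v b - v x) + B (u a - u x) (h x)) integrable_on {a..b}"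
          using * by blast
        show "(\<lambda>x. \<epsilon> * (norm (g x) + norm (h x))) integrable_on {a..b}"
          using ghI by (rule integrable_on_mult_right)
        fix x assume x: "x \<in> {a..b}"
        have "dist (u a) (u x) < \<epsilon> / K"
          using x ab bT by (intro d1(2)) (auto simp: dist_real_def)
        moreover have "dist (v b) (v x) < \<epsilon> / K"
          using x ab bT by (intro d2(2)) (auto simp: dist_real_def)
        ultimately have du: "norm (u a - u x) \<le> \<epsilon> / K" and dv: "norm (v b - v x) \<le> \<epsilon> / K"
          by (simp_all add: dist_norm)
        have "norm (B (g x) (v b - v x) + B (u a - u x) (h x))
            \<le> norm (g x) * norm (v b - v x) * K + norm (u a - u x) * norm (h x) * K"
          using K(2) by (intro norm_triangle_mono)
        also have "\<dots> \<le> norm (g x) * (\<epsilon> / K) * K + (\<epsilon> / K) * norm (h x) * K"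
          using du dv K(1) by (intro add_mono mult_right_mono mult_left_mono) auto
        also have "\<dots> = \<epsilon> * (norm (g x) + norm (h x))"
          using K(1) by (simp add: field_simps)
        finally show "norm (B (g x) (v b - v x) + B (u a - u x) (h x)) \<le> \<epsilon> * (norm (g x) + norm (h x))" .
      qed
      also have "\<dots> = \<epsilon> * (R b - R a)"
        unfolding R_def indefinite_integral_diff[OF gh ab(1,2) bT] by simp
      finally have "norm (B (u b) (v b) - B (u a) (v a) - integral {a..b} F) \<le> \<epsilon> * (R b - R a)"
        using * by (simp add: integral_unique)
      then show "norm ((B (u b) (v b) - integral {0..b} F) - (B (u a) (v a) - integral {0..a} F)) \<le> \<epsilon> * (R b - R a)"
        using I by (simp add: algebra_simps)
    qed (use d1 d2 in auto)
  qed
  have "B (u t) (v t) - B (u 0) (v 0) = integral {0..t} F" if "t \<in> {0..T}" for t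
    using key[OF that] by (simp add: algebra_simps)
  then show ?thesis
    using F unfolding is_primitive_def F_def[symmetric] by simp
qed

section \<open>Weak derivatives on the open interval in terms of gauge integrals on the closed
  one\<close>

lemma integrable_lebesgue_on_Ioo_iff:
  fixes f :: "real \<Rightarrow> 'a::euclidean_space"
  shows "integrable (lebesgue_on {a<..<b}) f \<longleftrightarrow> f absolutely_integrable_on {a..b}"
  unfolding absolutely_integrable_on_Icc_iff_Ioo
  unfolding set_integrable_def
  by (subst integrable_restrict_space) auto

lemma LINT_lebesgue_on_Ioo:
  fixes f :: "real \<Rightarrow> 'a::euclidean_space"
  assumes "f absolutely_integrable_on {a..b}"
  shows "(LINT t|lebesgue_on {a<..<b}. f t) = integral {a..b} f"
  using assms integrable_lebesgue_on_Ioo_iff[of a b f]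
  by (simp add: lebesgue_integral_eq_integral integral_open_interval_real)

lemma AE_lebesgue_on_Ioo_iff:
  "(AE t in lebesgue_on {a<..<b::real}. P t) \<longleftrightarrow> (\<exists>N. negligible N \<and> (\<forall>t\<in>{a<..<b} - N. P t))"
proof -
  have "(AE t in lebesgue_on {a<..<b}. P t) \<longleftrightarrow> (AE t in lebesgue. t \<in> {a<..<b} \<longrightarrow> P t)"
    by (rule AE_restrict_space_iff) simp
  also have "\<dots> \<longleftrightarrow> (\<exists>N. negligible N \<and> {t. \<not> (t \<in> {a<..<b} \<longrightarrow> P t)} \<subseteq> N)"
    by (rule eventually_ae_filter_negligible)
  also have "\<dots> \<longleftrightarrow> (\<exists>N. negligible N \<and> (\<forall>t\<in>{a<..<b} - N. P t))"
    by (intro ex_cong1 conj_cong refl) blast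
  finally show ?thesis .
qed

lemma has_weak_derivative_iff:
  "has_weak_derivative T u g \<longleftrightarrow> u absolutely_integrable_on {0..T} \<and> g absolutely_integrable_on {0..T} \<and>
    (\<forall>\<phi> \<phi>'. test_function T \<phi> \<phi>' \<longrightarrow>
      integral {0..T} (\<lambda>t. \<phi>' t *\<^sub>R u t) = - integral {0..T} (\<lambda>t. \<phi> t *\<^sub>R g t))"
proof -
  have "(\<lambda>t. \<phi>' t *\<^sub>R u t) absolutely_integrable_on {0..T}" "(\<lambda>t. \<phi> t *\<^sub>R g t) absolutely_integrable_on {0..T}"
    if "u absolutely_integrable_on {0..T}" "g absolutely_integrable_on {0..T}" "test_function T \<phi> \<phi>'" for \<phi> \<phi>'
  proof -
    have "continuous_on UNIV \<phi>" "continuous_on UNIV \<phi>'"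
      using that(3) unfolding test_function_def by (auto intro: DERIV_continuous_on)
    then have "continuous_on {0..T} \<phi>" "continuous_on {0..T} \<phi>'"
      by (auto intro: continuous_on_subset)
    then show "(\<lambda>t. \<phi>' t *\<^sub>R u t) absolutely_integrable_on {0..T}" "(\<lambda>t. \<phi> t *\<^sub>R g t) absolutely_integrable_on {0..T}"
      using that by (auto intro!: absolutely_integrable_bilinear_continuous[OF bounded_bilinear_scaleR])
  qed
  then show ?thesis
    unfolding has_weak_derivative_def integrable_lebesgue_on_Ioo_iff
    by (auto simp: LINT_lebesgue_on_Ioo)
qed

lemma test_function_is_primitive:
  assumes "test_function T \<phi> \<phi>'"
  shows "is_primitive T \<phi> \<phi>'" "\<phi> 0 = 0" "\<phi> T = 0"
proof -
  have "continuous_on {0..T} \<phi>'"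
    using assms unfolding test_function_def by (auto intro: continuous_on_subset)
  then have "\<phi>' absolutely_integrable_on {0..T}" by (rule absolutely_integrable_continuous_real)
  moreover have "\<phi> t - \<phi> 0 = integral {0..t} \<phi>'" if "0 \<le> t" for t
    using assms that unfolding test_function_def
    by (intro integral_unique[symmetric] fundamental_theorem_of_calculus)
       (auto simp flip: has_real_derivative_iff_has_vector_derivative intro: has_field_derivative_at_within)
  ultimately show "is_primitive T \<phi> \<phi>'"
    unfolding is_primitive_def by simp
  obtain K where K: "K \<subseteq> {0<..<T}" "\<And>t. t \<notin> K \<Longrightarrow> \<phi> t = 0"
    using assms unfolding test_function_def by blast
  show "\<phi> 0 = 0" "\<phi> T = 0" using K by (auto intro!: K(2))
qed

text \<open>Integration by parts: the Leibniz rule for the product with the test function, whose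
  values at \<open>0\<close> and \<open>T\<close> vanish.\<close>

lemma is_primitive_imp_has_weak_derivative:
  assumes T: "0 \<le> T" and u: "is_primitive T u g"
  shows "has_weak_derivative T u g"
  unfolding has_weak_derivative_iff
proof (intro conjI allI impI)
  show "u absolutely_integrable_on {0..T}"
    using is_primitive_continuous[OF u] by (rule absolutely_integrable_continuous_real)
  show g: "g absolutely_integrable_on {0..T}" using u by (simp add: is_primitive_def)
  fix \<phi> \<phi>' assume \<phi>: "test_function T \<phi> \<phi>'"
  note prim = test_function_is_primitive[OF \<phi>]
  have \<phi>': "\<phi>' absolutely_integrable_on {0..T}" using prim(1) by (simp add: is_primitive_def)
  have "is_primitive T (\<lambda>t. \<phi> t *\<^sub>R u t) (\<lambda>t. \<phi>' t *\<^sub>R u t + \<phi> t *\<^sub>R g t)"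
    using is_primitive_bilinear[OF bounded_bilinear_scaleR prim(1) u] .
  then have "integral {0..T} (\<lambda>t. \<phi>' t *\<^sub>R u t + \<phi> t *\<^sub>R g t) = 0"
    using T prim(2,3) is_primitive_diff[of T "\<lambda>t. \<phi> t *\<^sub>R u t" _ 0 T] by simp
  moreover have "(\<lambda>t. \<phi>' t *\<^sub>R u t) integrable_on {0..T}"
    using absolutely_integrable_bilinear_continuous[OF bounded_bilinear.flip[OF bounded_bilinear_scaleR]
        is_primitive_continuous[OF u] \<phi>'] by (simp add: absolutely_integrable_on_def)
  moreover have "(\<lambda>t. \<phi> t *\<^sub>R g t) integrable_on {0..T}"
    using absolutely_integrable_bilinear_continuous[OF bounded_bilinear_scaleR
        is_primitive_continuous[OF prim(1)] g] by (simp add: absolutely_integrable_on_def)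
  ultimately show "integral {0..T} (\<lambda>t. \<phi>' t *\<^sub>R u t) = - integral {0..T} (\<lambda>t. \<phi> t *\<^sub>R g t)"
    by (simp add: Henstock_Kurzweil_Integration.integral_add eq_neg_iff_add_eq_0)
qed

text \<open>The test function has derivative \<open>\<omega> (w - c)\<close>, where \<open>\<omega>\<close> is a positive weight on \<open>(a,b)\<close> and
  \<open>c\<close> is the \<open>\<omega>\<close>-weighted mean of \<open>w\<close>; this forces \<open>\<integral> \<omega> (w - c)\<^sup>2 = 0\<close>.\<close>

lemma du_Bois_Reymond_real:
  fixes w :: "real \<Rightarrow> real"
  assumes ab: "0 < a" "a < b" "b < T" and w: "continuous_on {0..T} w"
    and test: "\<And>\<phi> \<phi>'. test_function T \<phi> \<phi>' \<Longrightarrow> integral {0..T} (\<lambda>t. \<phi>' t * w t) = 0"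
  shows "\<exists>c. \<forall>x\<in>{a<..<b}. w x = c"
proof -
  \<comment> \<open>A continuous weight is smooth enough: it enters the derivative of the test
    function, which is only required to be continuous.\<close>
  define \<omega> where "\<omega> x = max 0 ((x - a) * (b - x))" for x
  \<comment> \<open>Clamping makes \<psi> continuous on the whole line although \<open>w\<close> is
    controlled on \<open>{0..T}\<close> only; where the clamp acts, \<omega> is zero.\<close>
  define k where "k x = max a (min b x)" for x
  define c where "c = integral {a..b} (\<lambda>x. \<omega> x * w x) / integral {a..b} \<omega>"
  define \<psi> where "\<psi> x = \<omega> x * (w (k x) - c)" for x
  define \<phi> where "\<phi> x = integral {0..x} \<psi>" for x
  have \<omega>_cont: "continuous_on S \<omega>" for S unfolding \<omega>_def by (intro continuous_intros)
  have \<omega>_pos: "\<omega> x > 0" if "x \<in> {a<..<b}" for x using that by (simp add: \<omega>_def)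
  have \<omega>_nonneg: "\<omega> x \<ge> 0" for x by (simp add: \<omega>_def)
  have w_ab: "continuous_on {a..b} w" using w ab by (auto intro: continuous_on_subset)
  have mid: "(a + b) / 2 \<in> {a<..<b}" "(a + b) / 2 \<in> {a..b}" using ab by auto
  have "integral {a..b} \<omega> \<noteq> 0"
    using integral_eq_0_iff[OF \<omega>_cont ab(2)] \<omega>_nonneg \<omega>_pos[OF mid(1)] mid(2) by (metis less_irrefl)
  have k_cont: "continuous_on UNIV k" unfolding k_def by (intro continuous_intros)
  have "range k \<subseteq> {a..b}" using ab by (auto simp: k_def)
  then have "continuous_on UNIV (\<lambda>x. w (k x))"
    by (rule continuous_on_compose2[OF w_ab k_cont])
  then have \<psi>_cont: "continuous_on S \<psi>" for S
    unfolding \<psi>_def by (intro continuous_intros \<omega>_cont) (auto intro: continuous_on_subset)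
  have \<psi>_int: "\<psi> integrable_on {x..y}" for x y by (intro integrable_continuous_real \<psi>_cont)
  have \<psi>_ab: "\<psi> x = \<omega> x * (w x - c)" if "x \<in> {a..b}" for x using that by (simp add: \<psi>_def k_def)
  have \<psi>_out: "\<psi> x = 0" if "x \<notin> {a..b}" for x
  proof -
    have "(x - a) * (b - x) \<le> 0"
      using that ab by (cases "x < a") (auto simp: mult_nonpos_nonneg mult_nonneg_nonpos)
    then show ?thesis by (simp add: \<psi>_def \<omega>_def)
  qed
  have \<omega>w: "(\<lambda>x. \<omega> x * w x) integrable_on {a..b}" "\<omega> integrable_on {a..b}"
    by (intro integrable_continuous_real continuous_intros \<omega>_cont w_ab)+
  \<comment> \<open>The weighted mean \<open>c\<close> is chosen for this integral to vanish: then
    \<phi> returns to zero at \<open>b\<close> and has compact support.\<close>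
  have "integral {a..b} \<psi> = integral {a..b} (\<lambda>x. \<omega> x * w x - c * \<omega> x)"
    by (intro Henstock_Kurzweil_Integration.integral_cong) (simp add: \<psi>_ab algebra_simps)
  also have "\<dots> = integral {a..b} (\<lambda>x. \<omega> x * w x) - c * integral {a..b} \<omega>"
    using \<omega>w by (subst Henstock_Kurzweil_Integration.integral_diff) (auto intro: integrable_on_mult_right)
  also have "\<dots> = 0" using \<open>integral {a..b} \<omega> \<noteq> 0\<close> by (simp add: c_def)
  finally have \<psi>0: "integral {a..b} \<psi> = 0" .
  have restrict: "integral S f = integral {a..b} f"
    if "{a..b} \<subseteq> S" "\<And>x. x \<notin> {a..b} \<Longrightarrow> f x = 0" for S and f :: "real \<Rightarrow> real"
  proof (rule integral_spike_set)
    have "{x \<in> S - {a..b}. f x \<noteq> 0} = {}" "{x \<in> {a..b} - S. f x \<noteq> 0} = {}"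
      using that by blast+
    then show "negligible {x \<in> S - {a..b}. f x \<noteq> 0}" "negligible {x \<in> {a..b} - S. f x \<noteq> 0}"
      by (simp_all only: negligible_empty)
  qed
  have \<phi>_left: "\<phi> x = 0" if "x < a" for x
    unfolding \<phi>_def using integral_cong[of "{0..x}" \<psi> "\<lambda>x. 0"] \<psi>_out that by simp
  have \<phi>_out: "\<phi> x = 0" if "x \<notin> {a..b}" for x
  proof (cases "x < a")
    case False
    then have "{a..b} \<subseteq> {0..x}" using that ab by auto
    then show ?thesis unfolding \<phi>_def using restrict[of "{0..x}" \<psi>] \<psi>_out \<psi>0 by simp
  qed (rule \<phi>_left)
  have "(\<phi> has_real_derivative \<psi> t) (at t)" for t
  \<comment> \<open>Left of \<open>a\<close>, negative times included, \<phi> is locally zero. The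
    fundamental theorem on \<open>{0..t + 1}\<close> needs \<open>t\<close> in the interior, which
    \<open>a > 0\<close> provides otherwise.\<close>
  proof (cases "t < a")
    case True
    have "((\<lambda>x. 0) has_real_derivative 0) (at t)" by simp
    then have "(\<phi> has_real_derivative 0) (at t)"
      by (rule has_field_derivative_transform_within_open[of _ _ _ "{..<a}"]) (use True \<phi>_left in auto)
    then show ?thesis using \<psi>_out[of t] True by simp
  next
    case False
    then have t: "t \<in> {0..t + 1}" "0 < t" using ab by auto
    have "(\<phi> has_real_derivative \<psi> t) (at t within {0..t + 1})"
      unfolding \<phi>_def by (rule integral_has_real_derivative[OF \<psi>_cont t(1)])
    then show ?thesis using at_within_Icc_at[of 0 t "t + 1"] t by simp
  qed
  then have "test_function T \<phi> \<psi>"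
    unfolding test_function_def using \<psi>_cont[of UNIV] \<phi>_out ab
    by (auto intro!: exI[of _ "{a..b}"])
  then have "integral {0..T} (\<lambda>t. \<psi> t * w t) = 0" by (rule test)
  moreover have "integral {0..T} (\<lambda>t. \<psi> t * w t) = integral {a..b} (\<lambda>t. \<psi> t * w t)"
    using ab by (intro restrict) (auto simp: \<psi>_out)
  ultimately have \<psi>w: "integral {a..b} (\<lambda>t. \<psi> t * w t) = 0" by simp
  have "integral {a..b} (\<lambda>t. \<psi> t * (w t - c)) = integral {a..b} (\<lambda>t. \<psi> t * w t - c * \<psi> t)"
    by (intro Henstock_Kurzweil_Integration.integral_cong) (simp add: algebra_simps)
  also have "\<dots> = integral {a..b} (\<lambda>t. \<psi> t * w t) - c * integral {a..b} \<psi>"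
    using \<psi>_int
    by (subst Henstock_Kurzweil_Integration.integral_diff)
       (auto intro!: integrable_on_mult_right integrable_continuous_real continuous_intros \<psi>_cont w_ab)
  finally have "integral {a..b} (\<lambda>t. \<psi> t * (w t - c)) = 0" using \<psi>w \<psi>0 by simp
  moreover have "continuous_on {a..b} (\<lambda>t. \<psi> t * (w t - c))"
    by (intro continuous_intros \<psi>_cont w_ab)
  moreover have "0 \<le> \<psi> t * (w t - c)" if "t \<in> {a..b}" for t
    using \<omega>_nonneg[of t] by (simp add: \<psi>_ab[OF that] mult.assoc)
  ultimately have zero: "\<psi> t * (w t - c) = 0" if "t \<in> {a..b}" for t
    using integral_eq_0_iff[of a b "\<lambda>t. \<psi> t * (w t - c)"] ab that by blast
  have "w x = c" if "x \<in> {a<..<b}" for x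
  proof -
    have "x \<in> {a..b}" using that by auto
    then show ?thesis using zero[of x] \<psi>_ab[of x] \<omega>_pos[OF that] by simp
  qed
  then show ?thesis by blast
qed

lemma du_Bois_Reymond:
  fixes w :: "real \<Rightarrow> 'a::euclidean_space"
  assumes T: "0 < T" and w: "continuous_on {0..T} w"
    and test: "\<And>\<phi> \<phi>'. test_function T \<phi> \<phi>' \<Longrightarrow> integral {0..T} (\<lambda>t. \<phi>' t *\<^sub>R w t) = 0"
    and t: "t \<in> {0..T}"
  shows "w t = w 0"
proof -
  have const: "w x = w y" if x: "x \<in> {0<..<T}" and y: "y \<in> {0<..<T}" for x y
  proof (rule euclidean_eqI)
    fix i :: 'a assume i: "i \<in> Basis"
    \<comment> \<open>These end points lie strictly inside \<open>{0<..<T}\<close> and enclose both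
      \<open>x\<close> and \<open>y\<close>.\<close>
    have "\<exists>c. \<forall>z\<in>{min x y / 2<..<(max x y + T) / 2}. w z \<bullet> i = c"
    proof (rule du_Bois_Reymond_real[where T = T])
      show "continuous_on {0..T} (\<lambda>z. w z \<bullet> i)" using w by (intro continuous_intros)
      fix \<phi> \<phi>' assume \<phi>: "test_function T \<phi> \<phi>'"
      have "continuous_on {0..T} \<phi>'"
        using \<phi> unfolding test_function_def by (auto intro: continuous_on_subset)
      then have int: "(\<lambda>t. \<phi>' t *\<^sub>R w t) integrable_on {0..T}"
        using w by (intro integrable_continuous_real continuous_intros)
      have "integral {0..T} (\<lambda>t. (\<phi>' t *\<^sub>R w t) \<bullet> i) = integral {0..T} (\<lambda>t. \<phi>' t *\<^sub>R w t) \<bullet> i"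
        using integral_linear[OF int bounded_linear_inner_left[of i]] by (simp add: o_def)
      then show "integral {0..T} (\<lambda>t. \<phi>' t * (w t \<bullet> i)) = 0" using test[OF \<phi>] by simp
    qed (use x y in auto)
    moreover have "x \<in> {min x y / 2<..<(max x y + T) / 2}" "y \<in> {min x y / 2<..<(max x y + T) / 2}"
      using x y by auto
    ultimately show "w x \<bullet> i = w y \<bullet> i" by metis
  qed
  have cl: "closure {0<..<T} = {0..T}" using T by simp
  have "w x = w (T / 2)" if "x \<in> {0<..<T}" for x using const[OF that] T by simp
  then have "w s = w (T / 2)" if "s \<in> {0..T}" for s
    using continuous_constant_on_closure[of "{0<..<T}" w "w (T / 2)" s] that w
    unfolding cl by blast
  from this[OF t] this[of 0] T show ?thesis by simp
qed

lemma abs_continuous_imp_continuous: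
  assumes "abs_continuous_on_interval a b u"
  shows "continuous_on {a..b} u"
proof -
  have *: "\<exists>\<delta>>0. \<forall>s t. a \<le> s \<longrightarrow> s \<le> t \<longrightarrow> t \<le> b \<longrightarrow> t - s < \<delta> \<longrightarrow> norm (u t - u s) < \<epsilon>"
    if "\<epsilon> > 0" for \<epsilon>
  proof -
    obtain \<delta> where \<delta>: "\<delta> > 0" "\<And>D. D division_of \<Union>D \<Longrightarrow> \<Union>D \<subseteq> {a..b} \<Longrightarrow> (\<Sum>K\<in>D. Sup K - Inf K) < \<delta> \<Longrightarrow>
       (\<Sum>K\<in>D. norm (u (Sup K) - u (Inf K))) < \<epsilon>"
      using assms \<open>\<epsilon> > 0\<close> unfolding abs_continuous_on_interval_def by meson
    have "norm (u t - u s) < \<epsilon>" if "a \<le> s" "s \<le> t" "t \<le> b" "t - s < \<delta>" for s t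
      using \<delta>(2)[of "{{s..t}}"] that division_of_self[of s t] by (auto simp: box_real)
    then show ?thesis using \<delta>(1) by blast
  qed
  show ?thesis
    unfolding continuous_on_iff
  proof (intro ballI allI impI)
    fix x \<epsilon> :: real assume x: "x \<in> {a..b}" and "\<epsilon> > 0"
    obtain \<delta> where \<delta>: "\<delta> > 0" "\<And>s t. a \<le> s \<Longrightarrow> s \<le> t \<Longrightarrow> t \<le> b \<Longrightarrow> t - s < \<delta> \<Longrightarrow> norm (u t - u s) < \<epsilon>"
      using *[OF \<open>\<epsilon> > 0\<close>] by blast
    have "dist (u y) (u x) < \<epsilon>" if "y \<in> {a..b}" "dist y x < \<delta>" for y
      using \<delta>(2)[of x y] \<delta>(2)[of y x] x that
      by (cases "x \<le> y") (auto simp: dist_norm norm_minus_commute)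
    then show "\<exists>d>0. \<forall>y\<in>{a..b}. dist y x < d \<longrightarrow> dist (u y) (u x) < \<epsilon>" using \<delta>(1) by blast
  qed
qed

text \<open>\<open>u\<close> and the indefinite integral of \<open>g\<close> are continuous with the
  same weak derivative, so their difference is constant by the du Bois-Reymond lemma.\<close>

lemma abs_continuous_weak_derivative_imp_primitive:
  fixes u :: "real \<Rightarrow> 'a::euclidean_space"
  assumes T: "0 < T" and u: "abs_continuous_on_interval 0 T u" "has_weak_derivative T u g"
  shows "is_primitive T u g"
proof -
  have g: "g absolutely_integrable_on {0..T}" using u(2) by (simp add: has_weak_derivative_iff)
  define v where "v t = integral {0..t} g" for t
  have v: "is_primitive T v g" using g by (simp add: is_primitive_def v_def)
  have v_cont: "continuous_on {0..T} v" by (rule is_primitive_continuous[OF v])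
  have u_cont: "continuous_on {0..T} u" by (rule abs_continuous_imp_continuous[OF u(1)])
  have const: "u t - v t = u 0 - v 0" if "t \<in> {0..T}" for t
  proof (rule du_Bois_Reymond[OF T _ _ that])
    show "continuous_on {0..T} (\<lambda>t. u t - v t)" by (intro continuous_intros u_cont v_cont)
    fix \<phi> \<phi>' assume \<phi>: "test_function T \<phi> \<phi>'"
    have c: "continuous_on {0..T} \<phi>'"
      using \<phi> unfolding test_function_def by (auto intro: continuous_on_subset)
    have "integral {0..T} (\<lambda>t. \<phi>' t *\<^sub>R u t) = integral {0..T} (\<lambda>t. \<phi>' t *\<^sub>R v t)"
      using u(2) is_primitive_imp_has_weak_derivative[OF _ v] T \<phi> by (auto simp: has_weak_derivative_iff)
    moreover have "integral {0..T} (\<lambda>t. \<phi>' t *\<^sub>R u t - \<phi>' t *\<^sub>R v t)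
        = integral {0..T} (\<lambda>t. \<phi>' t *\<^sub>R u t) - integral {0..T} (\<lambda>t. \<phi>' t *\<^sub>R v t)"
      by (intro Henstock_Kurzweil_Integration.integral_diff integrable_continuous_real continuous_intros c u_cont v_cont)
    ultimately show "integral {0..T} (\<lambda>t. \<phi>' t *\<^sub>R (u t - v t)) = 0" by (simp add: scaleR_diff_right)
  qed
  show ?thesis
    unfolding is_primitive_def
  proof (intro conjI ballI g)
    fix t assume t: "t \<in> {0..T}"
    have "v 0 = 0" by (simp add: v_def)
    then show "u t - u 0 = integral {0..t} g" using const[OF t] by (simp add: v_def algebra_simps)
  qed
qed

text \<open>Lebesgue differentiation over cubes with lower corner \<open>t\<close>, which in
  dimension one are the intervals \<open>{t..t + h}\<close>; hence right derivatives. Extension by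
  zero makes the density integrable on every interval.\<close>

lemma is_primitive_ae_right_derivative:
  fixes u :: "real \<Rightarrow> 'a::euclidean_space"
  assumes u: "is_primitive T u g"
  shows "\<exists>N. negligible N \<and> (\<forall>t\<in>{0<..<T} - N. ((\<lambda>h. (u (t + h) - u t) /\<^sub>R h) \<longlongrightarrow> g t) (at_right 0))"
proof -
  define f where "f x = (if x \<in> {0..T} then g x else 0)" for x
  have "g absolutely_integrable_on {0..T}" using u by (simp add: is_primitive_def)
  then have "f integrable_on UNIV"
    unfolding f_def integrable_restrict_UNIV by (simp add: absolutely_integrable_on_def)
  then have "f integrable_on cbox a b" for a b by (rule integrable_on_subcbox) simp
  then obtain N where N: "negligible N" "\<And>x e. x \<notin> N \<Longrightarrow> 0 < e \<Longrightarrow>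
      \<exists>d>0. \<forall>h. 0 < h \<and> h < d \<longrightarrow> norm (integral (cbox x (x + h *\<^sub>R One)) f /\<^sub>R h ^ DIM(real) - f x) < e"
    by (rule integrable_ccontinuous_explicit) blast
  have "((\<lambda>h. (u (t + h) - u t) /\<^sub>R h) \<longlongrightarrow> g t) (at_right 0)" if t: "t \<in> {0<..<T} - N" for t
  proof (rule tendstoI)
    fix e :: real assume "e > 0"
    then obtain d where d: "d > 0" "\<And>h. 0 < h \<Longrightarrow> h < d \<Longrightarrow> norm (integral {t..t + h} f /\<^sub>R h - f t) < e"
      using N(2)[of t e] t by auto
    have "dist ((u (t + h) - u t) /\<^sub>R h) (g t) < e" if h: "0 < h" "h < min d (T - t)" for h
    proof -
      have "integral {t..t + h} f = integral {t..t + h} g"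
        using t h by (intro Henstock_Kurzweil_Integration.integral_cong) (auto simp: f_def)
      also have "\<dots> = u (t + h) - u t" using is_primitive_diff[OF u, of t "t + h"] t h by simp
      finally show ?thesis using d(2)[of h] h t by (simp add: dist_norm f_def)
    qed
    then show "\<forall>\<^sub>F h in at_right 0. dist ((u (t + h) - u t) /\<^sub>R h) (g t) < e"
      using d(1) t by (intro eventually_at_rightI[of 0 "min d (T - t)"]) auto
  qed
  then show ?thesis using N(1) by blast
qed

lemma is_primitive_ae_unique:
  assumes "is_primitive T u g" "is_primitive T u h"
  shows "\<exists>N. negligible N \<and> (\<forall>t\<in>{0<..<T} - N. g t = h t)"
proof -
  obtain N1 where N1: "negligible N1"
    "\<And>t. t \<in> {0<..<T} - N1 \<Longrightarrow> ((\<lambda>\<delta>. (u (t + \<delta>) - u t) /\<^sub>R \<delta>) \<longlongrightarrow> g t) (at_right 0)"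
    using is_primitive_ae_right_derivative[OF assms(1)] by blast
  obtain N2 where N2: "negligible N2"
    "\<And>t. t \<in> {0<..<T} - N2 \<Longrightarrow> ((\<lambda>\<delta>. (u (t + \<delta>) - u t) /\<^sub>R \<delta>) \<longlongrightarrow> h t) (at_right 0)"
    using is_primitive_ae_right_derivative[OF assms(2)] by blast
  have "g t = h t" if "t \<in> {0<..<T} - (N1 \<union> N2)" for t
    using tendsto_unique[OF trivial_limit_at_right_real N1(2) N2(2)] that by blast
  then show ?thesis
    using N1(1) N2(1) negligible_Un by blast
qed

section \<open>The sweeping process\<close>

lemma W11_imp_primitive:
  assumes "0 < T" "u \<in> W11 T C"
  shows "\<exists>g. is_primitive T u g"
  using assms abs_continuous_weak_derivative_imp_primitive unfolding W11_def by blast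

lemma is_primitive_nonpos_derivative:
  fixes u :: "real \<Rightarrow> real"
  assumes u: "is_primitive T u g" and N: "negligible N" "\<And>t. t \<in> {0<..<T} - N \<Longrightarrow> g t \<le> 0"
    and t: "t \<in> {0..T}"
  shows "u t \<le> u 0"
proof -
  \<comment> \<open>The sign is known on the open interval off \<open>N\<close>, so the end points
    join the exceptional set; \<open>min (g x) 0\<close> then serves as a version of
    \<open>g\<close> that is nonpositive everywhere.\<close>
  have neg: "negligible (insert 0 (insert T N))" using N(1) by simp
  have eq: "min (g x) 0 = g x" if "x \<in> {0..t} - insert 0 (insert T N)" for x
    using N(2)[of x] that t by (auto simp: min_def)
  have "g integrable_on {0..t}"
    using u t absolutely_integrable_on_subinterval_0T(1)[where T = T and g = g] by (auto simp: is_primitive_def)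
  then have "(\<lambda>x. min (g x) 0) integrable_on {0..t}"
    by (rule integrable_spike[OF _ neg eq])
  then have "integral {0..t} (\<lambda>x. min (g x) 0) \<le> integral {0..t} (\<lambda>x. 0)"
    by (intro integral_le) auto
  also have "integral {0..t} (\<lambda>x. min (g x) 0) = integral {0..t} g"
    using integral_spike[OF neg, of "{0..t}" "\<lambda>x. min (g x) 0" g] eq by simp
  finally have "integral {0..t} g \<le> 0" by simp
  moreover have "u t - u 0 = integral {0..t} g" using u t by (simp add: is_primitive_def)
  ultimately show ?thesis by simp
qed

text \<open>Testing each inclusion with the other solution shows that the squared distance has a
  nonpositive derivative almost everywhere, and it starts at zero.\<close>

lemma sweeping_solution_unique:
  fixes C :: "'a::euclidean_space set"
  assumes T: "0 < T" and \<pi>: "\<pi> \<in> W11 T UNIV"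
    and \<sigma>1: "sweeping_solution C T \<pi> \<sigma>1" and \<sigma>2: "sweeping_solution C T \<pi> \<sigma>2" and t: "t \<in> {0..T}"
  shows "\<sigma>1 t = \<sigma>2 t"
proof -
  have ac: "abs_continuous_on_interval 0 T \<pi>" "abs_continuous_on_interval 0 T \<sigma>1" "abs_continuous_on_interval 0 T \<sigma>2"
    and val: "\<And>s. s \<in> {0..T} \<Longrightarrow> \<sigma>1 s \<in> C" "\<And>s. s \<in> {0..T} \<Longrightarrow> \<sigma>2 s \<in> C"
    using \<pi> \<sigma>1 \<sigma>2 by (auto simp: sweeping_solution_def W11_def)
  obtain p1 q1 where 1: "is_primitive T \<pi> p1" "is_primitive T \<sigma>1 q1"
      "AE t in lebesgue_on {0<..<T}. p1 t - q1 t \<in> normal_cone C (\<sigma>1 t)"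
    using \<sigma>1 abs_continuous_weak_derivative_imp_primitive[OF T] ac unfolding sweeping_solution_def by blast
  obtain p2 q2 where 2: "is_primitive T \<pi> p2" "is_primitive T \<sigma>2 q2"
      "AE t in lebesgue_on {0<..<T}. p2 t - q2 t \<in> normal_cone C (\<sigma>2 t)"
    using \<sigma>2 abs_continuous_weak_derivative_imp_primitive[OF T] ac unfolding sweeping_solution_def by blast
  obtain N1 where N1: "negligible N1" "\<And>t. t \<in> {0<..<T} - N1 \<Longrightarrow> p1 t - q1 t \<in> normal_cone C (\<sigma>1 t)"
    using 1(3) unfolding AE_lebesgue_on_Ioo_iff by blast
  obtain N2 where N2: "negligible N2" "\<And>t. t \<in> {0<..<T} - N2 \<Longrightarrow> p2 t - q2 t \<in> normal_cone C (\<sigma>2 t)"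
    using 2(3) unfolding AE_lebesgue_on_Ioo_iff by blast
  \<comment> \<open>Each solution comes with its own version of the derivative of \<pi>; the two
    versions must be identified before the inclusions can be added.\<close>
  obtain N3 where N3: "negligible N3" "\<And>t. t \<in> {0<..<T} - N3 \<Longrightarrow> p1 t = p2 t"
    using is_primitive_ae_unique[OF 1(1) 2(1)] by blast
  define w where "w t = \<sigma>1 t - \<sigma>2 t" for t
  define q where "q t = q1 t - q2 t" for t
  have "is_primitive T w q"
    unfolding w_def q_def by (rule is_primitive_minus[OF 1(2) 2(2)])
  then have "is_primitive T (\<lambda>t. w t \<bullet> w t) (\<lambda>t. q t \<bullet> w t + w t \<bullet> q t)"
    by (intro is_primitive_bilinear[OF bounded_bilinear_inner])
  then have "w t \<bullet> w t \<le> w 0 \<bullet> w 0"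
  proof (rule is_primitive_nonpos_derivative[OF _ _ _ t])
    show "negligible (N1 \<union> N2 \<union> N3)" using N1 N2 N3 by simp
    fix s assume s: "s \<in> {0<..<T} - (N1 \<union> N2 \<union> N3)"
    then have "(p1 s - q1 s) \<bullet> (\<sigma>2 s - \<sigma>1 s) \<le> 0" "(p2 s - q2 s) \<bullet> (\<sigma>1 s - \<sigma>2 s) \<le> 0" "p1 s = p2 s"
      using N1(2)[of s] N2(2)[of s] N3(2)[of s] val[of s] unfolding normal_cone_def by auto
    then show "q s \<bullet> w s + w s \<bullet> q s \<le> 0"
      by (simp add: q_def w_def inner_diff_left inner_diff_right inner_commute)
  qed
  also have "w 0 = 0" using \<sigma>1 \<sigma>2 by (simp add: w_def sweeping_solution_def)
  finally have "w t = 0" using inner_ge_zero[of "w t"] inner_eq_zero_iff[of "w t"] by fastforce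
  then show ?thesis by (simp add: w_def)
qed

section \<open>Dyadic grids\<close>

definition node :: "real \<Rightarrow> nat \<Rightarrow> nat \<Rightarrow> real" where
  "node T n k = real k * T / 2 ^ n"

text \<open>Rounding down selects the last node not after \<open>t\<close>, so the scheme read off
  at \<open>t\<close> uses no input from later times: causality holds already on each grid.\<close>

definition node_index :: "real \<Rightarrow> nat \<Rightarrow> real \<Rightarrow> nat" where
  "node_index T n t = nat \<lfloor>t * 2 ^ n / T\<rfloor>"

definition catch_up_at :: "'a::euclidean_space set \<Rightarrow> real \<Rightarrow> (real \<Rightarrow> 'a) \<Rightarrow> nat \<Rightarrow> real \<Rightarrow> 'a" where
  "catch_up_at C T \<pi> n t = catch_up C (\<lambda>k. \<pi> (node T n k)) (node_index T n t)"

lemma node_0: "node T n 0 = 0"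
  by (simp add: node_def)

lemma node_last: "node T n (2 ^ n) = T"
  by (simp add: node_def)

lemma node_refine: "n \<le> m \<Longrightarrow> node T m (2 ^ (m - n) * k) = node T n k"
  using power_add[of "2::real" "m - n" n] by (simp add: node_def)

lemma node_add: "node T n (k + l) = node T n k + real l * T / 2 ^ n"
  by (simp add: node_def ring_distribs add_divide_distrib)

lemma node_index_0: "node_index T n 0 = 0"
  by (simp add: node_index_def)

context
  fixes T :: real
  assumes T: "0 < T"
begin

lemma node_nonneg: "0 \<le> node T n k"
  using T by (simp add: node_def)

lemma node_less: "k < l \<Longrightarrow> node T n k < node T n l"
  using T by (simp add: node_def divide_strict_right_mono)

lemma node_mono: "k \<le> l \<Longrightarrow> node T n k \<le> node T n l"
  using T by (simp add: node_def divide_right_mono mult_right_mono)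

lemma node_in: "k \<le> 2 ^ n \<Longrightarrow> node T n k \<in> {0..T}"
  using node_mono[of k "2 ^ n" n] node_last node_nonneg by simp

lemma node_index_last: "node_index T n T = 2 ^ n"
proof -
  have "T * 2 ^ n / T = of_int (2 ^ n)" using T by simp
  then show ?thesis unfolding node_index_def by (simp only: floor_of_int) (simp add: nat_power_eq)
qed

lemma node_index_mono: "s \<le> t \<Longrightarrow> node_index T n s \<le> node_index T n t"
  using T unfolding node_index_def by (intro nat_mono floor_mono divide_right_mono mult_right_mono) auto

lemma node_index_le: "t \<le> T \<Longrightarrow> node_index T n t \<le> 2 ^ n"
  using node_index_mono[of t T n] node_index_last by simp

lemma node_node_index:
  assumes "0 \<le> t"
  shows "node T n (node_index T n t) \<le> t" "t < node T n (node_index T n t) + T / 2 ^ n"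
proof -
  let ?x = "t * 2 ^ n / T"
  have "0 \<le> ?x" using assms T by simp
  then have "real (node_index T n t) = of_int \<lfloor>?x\<rfloor>" by (simp add: node_index_def)
  then have "real (node_index T n t) \<le> ?x" "?x < real (node_index T n t) + 1" by linarith+
  then show "node T n (node_index T n t) \<le> t" "t < node T n (node_index T n t) + T / 2 ^ n"
    using T by (auto simp: node_def field_simps)
qed

text \<open>Nested floors collapse. This matches the \<open>k div m\<close> of
  \<open>catch_up_coarse\<close>: the coarse index of a time is its fine index divided by the number
  of fine cells in a coarse cell.\<close>

lemma node_index_coarse:
  assumes "n \<le> m" "0 \<le> t"
  shows "node_index T m t div 2 ^ (m - n) = node_index T n t"
proof -
  have "t * 2 ^ m / T / of_int (2 ^ (m - n)) = t * 2 ^ n / T"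
    using assms(1) power_add[of "2::real" "m - n" n] by simp
  then have "\<lfloor>t * 2 ^ n / T\<rfloor> = \<lfloor>t * 2 ^ m / T\<rfloor> div 2 ^ (m - n)"
    using floor_divide_real_eq_div[of "2 ^ (m - n)" "t * 2 ^ m / T"] by simp
  then show ?thesis
    using assms T by (simp add: node_index_def nat_div_distrib nat_power_eq)
qed

lemma node_node_index_tendsto:
  assumes "t \<in> {0..T}"
  shows "(\<lambda>n. node T n (node_index T n t)) \<longlonglongrightarrow> t"
proof (rule tendsto_sandwich)
  have "(\<lambda>n. t - T * (1 / 2) ^ n) \<longlonglongrightarrow> t - T * 0"
    by (intro tendsto_intros LIMSEQ_realpow_zero) auto
  then show "(\<lambda>n. t - T / 2 ^ n) \<longlonglongrightarrow> t" by (simp add: power_one_over)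
  show "\<forall>\<^sub>F n in sequentially. t - T / 2 ^ n \<le> node T n (node_index T n t)"
    using node_node_index(2)[of t] assms by (auto intro!: always_eventually simp: diff_le_eq less_imp_le)
  show "\<forall>\<^sub>F n in sequentially. node T n (node_index T n t) \<le> t"
    using node_node_index(1)[of t] assms by (auto intro!: always_eventually)
qed simp

lemma sum_norm_nodes_le_variation:
  "ennreal (\<Sum>k<2 ^ n. norm (u (node T n (Suc k)) - u (node T n k))) \<le> variation T u"
proof -
  have "(\<Sum>k<2 ^ n. norm (u (node T n (Suc k)) - u (node T n k)))
      = (\<Sum>j=1..2 ^ n. norm (u (node T n j) - u (node T n (j - 1))))"
    by (simp add: sum.atLeast1_atMost_eq)
  moreover have "(2 ^ n, node T n) \<in> {(m::nat, t::nat \<Rightarrow> real). t 0 = 0 \<and> t m = T \<and> (\<forall>j\<in>{1..m}. t (j - 1) < t j)}"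
    by (auto simp: node_0 node_last intro!: node_less)
  ultimately show ?thesis
    unfolding variation_def by (auto intro!: SUP_upper2)
qed

end

text \<open>\<open>compare\<close> makes the plastic parts Cauchy at every time. The discrete bounds
  are stated through \<open>R\<close> and \<pi> at the nodes just before a time, so continuity of
  both carries them to the limit.\<close>

lemma catch_up_scheme_converges:
  fixes C :: "'a::euclidean_space set"
  assumes T: "0 < T" and C: "C \<noteq> {}" "closed C" "convex C" and \<pi>: "\<pi> \<in> W11 T UNIV"
  shows "\<exists>\<sigma>. \<sigma> \<in> extensional {0..T} \<and> sweeping_solution C T \<pi> \<sigma> \<and>
    (\<forall>t\<in>{0..T}. (\<lambda>n. catch_up_at C T \<pi> n t) \<longlonglongrightarrow> \<sigma> t)"
proof -
  obtain p where p: "is_primitive T \<pi> p" using W11_imp_primitive[OF T \<pi>] by blast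
  define \<rho> where "\<rho> x = norm (p x)" for x
  \<comment> \<open>The control function: its increments dominate those of \<pi>, of the schemes'
    variation sums and of the limiting plastic part.\<close>
  define R where "R t = integral {0..t} \<rho>" for t
  have \<rho>: "\<rho> absolutely_integrable_on {0..T}"
    unfolding \<rho>_def using p by (auto simp: is_primitive_def intro: set_integrable_norm)
  have \<rho>_nonneg: "0 \<le> \<rho> t" for t by (simp add: \<rho>_def)
  have R: "is_primitive T R \<rho>" using \<rho> by (simp add: is_primitive_def R_def)
  have R_cont: "continuous_on {0..T} R" by (rule is_primitive_continuous[OF R])
  have \<pi>_cont: "continuous_on {0..T} \<pi>" by (rule is_primitive_continuous[OF p])
  have \<pi>_R: "norm (\<pi> t - \<pi> s) \<le> R t - R s" if "0 \<le> s" "s \<le> t" "t \<le> T" for s t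
    using is_primitive_norm_diff[OF p that] is_primitive_diff[OF R that] by (simp add: \<rho>_def[abs_def])
  have R_mono: "R s \<le> R t" if "0 \<le> s" "s \<le> t" "t \<le> T" for s t
    using \<pi>_R[OF that] norm_ge_zero[of "\<pi> t - \<pi> s"] by linarith
  have R0: "R 0 = 0" by (simp add: R_def)

  define i where "i = node_index T"
  define v where "v n k = \<pi> (node T n k)" for n k
  define X where "X n t = catch_up C (v n) (i n t)" for n t
  define \<Xi> where "\<Xi> n t = plastic C (v n) (i n t)" for n t
  have X: "X n t = v n (i n t) - \<Xi> n t" for n t
    by (simp add: X_def \<Xi>_def plastic_def)
  have i_le: "i n t \<le> 2 ^ n" if "t \<in> {0..T}" for n t
    using node_index_le[OF T] that by (simp add: i_def)
  have sum_R: "(\<Sum>k=a..<b. norm (\<pi> (s (Suc k)) - \<pi> (s k))) \<le> R (s b) - R (s a)"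
    if "a \<le> b" "\<And>k. k \<le> b \<Longrightarrow> s k \<in> {0..T}" "\<And>k. k < b \<Longrightarrow> s k \<le> s (Suc k)" for a b and s :: "nat \<Rightarrow> real"
  proof -
    have "(\<Sum>k=a..<b. norm (\<pi> (s (Suc k)) - \<pi> (s k))) \<le> (\<Sum>k=a..<b. R (s (Suc k)) - R (s k))"
    proof (rule sum_mono)
      fix k assume "k \<in> {a..<b}"
      then show "norm (\<pi> (s (Suc k)) - \<pi> (s k)) \<le> R (s (Suc k)) - R (s k)"
        using that(2)[of k] that(2)[of "Suc k"] that(3)[of k] by (intro \<pi>_R) auto
    qed
    also have "\<dots> = R (s b) - R (s a)" by (rule sum_Suc_diff'[OF that(1)])
    finally show ?thesis .
  qed
  have sum_R0: "(\<Sum>k<b. norm (\<pi> (s (Suc k)) - \<pi> (s k))) \<le> R T"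
    if "\<And>k. k \<le> b \<Longrightarrow> s k \<in> {0..T}" "\<And>k. k < b \<Longrightarrow> s k \<le> s (Suc k)" for b and s :: "nat \<Rightarrow> real"
    using sum_R[of 0 b s] that R_mono[of "s b" T] R_mono[of 0 "s 0"] R0 that(1)[of b] that(1)[of 0]
    by (auto simp: atLeast0LessThan)
  have sum_v: "(\<Sum>k=i n s..<i n t. norm (v n (Suc k) - v n k))
      \<le> R (node T n (i n t)) - R (node T n (i n s))" if "0 \<le> s" "s \<le> t" "t \<le> T" for n s t
    unfolding v_def
  proof (rule sum_R)
    show "i n s \<le> i n t" using node_index_mono[OF T] that by (simp add: i_def)
    show "node T n k \<in> {0..T}" if "k \<le> i n t" for k
      using that i_le[of t n] \<open>0 \<le> s\<close> \<open>s \<le> t\<close> \<open>t \<le> T\<close> by (intro node_in[OF T]) auto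
  qed (intro node_mono[OF T]; simp)
  have R_node: "(\<lambda>n. R (node T n (i n t))) \<longlonglongrightarrow> R t"
    and v_node: "(\<lambda>n. v n (i n t)) \<longlonglongrightarrow> \<pi> t" if "t \<in> {0..T}" for t
    using continuous_on_tendsto_compose[OF R_cont node_node_index_tendsto[OF T that] that]
      continuous_on_tendsto_compose[OF \<pi>_cont node_node_index_tendsto[OF T that] that]
      i_le[OF that] node_in[OF T] by (auto simp: i_def v_def)

  have compare: "(norm (\<Xi> n t - \<Xi> m t))\<^sup>2 \<le> 2 * \<epsilon> * (2 * R T)"
    if nm: "n \<le> m" and t: "t \<in> {0..T}"
      and \<epsilon>: "\<And>a b. a \<in> {0..T} \<Longrightarrow> b \<in> {0..T} \<Longrightarrow> \<bar>b - a\<bar> < T / 2 ^ n \<Longrightarrow> norm (\<pi> b - \<pi> a) \<le> \<epsilon>"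
    for n m t \<epsilon>
  proof -
    define M :: nat where "M = 2 ^ (m - n)"
    have M: "M > 0" by (simp add: M_def)
    \<comment> \<open>The level-\<open>n\<close> samples, held constant along the
      level-\<open>m\<close> grid. They deviate from the fine samples by at most the oscillation of
      \<pi> on a coarse cell.\<close>
    define w where "w k = v m (M * (k div M))" for k
    have coarse: "v m (M * k) = v n k" for k
      using node_refine[OF nm] by (simp add: v_def M_def)
    have "i m t div M = i n t"
      using node_index_coarse[OF T nm] t by (simp add: i_def M_def)
    then have w: "plastic C w (i m t) = \<Xi> n t"
      unfolding plastic_def \<Xi>_def w_def using catch_up_coarse[OF C M, of "v m" "i m t"] by (simp add: coarse)
    have in_T: "node T m k \<in> {0..T}" if "k \<le> i m t" for k
      using that i_le[OF t, of m] by (intro node_in[OF T]) simp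
    have div_le: "M * (k div M) \<le> k" for k by simp
    have "0 \<le> \<epsilon>" using \<epsilon>[of 0 0] T by simp
    have "(norm (plastic C (v m) (i m t) - plastic C w (i m t)))\<^sup>2
        \<le> 2 * \<epsilon> * (\<Sum>k<i m t. norm (v m (Suc k) - v m k) + norm (w (Suc k) - w k))"
    proof (rule plastic_comparison[OF C])
      show "v m 0 = w 0" by (simp add: w_def)
      fix k assume k: "k \<le> i m t"
      have "node T m k = node T m (M * (k div M)) + real (k mod M) * T / 2 ^ m"
        using node_add[of T m "M * (k div M)" "k mod M"] by simp
      moreover have "real (k mod M) * T / 2 ^ m < real M * T / 2 ^ m"
        using M T by (intro divide_strict_right_mono mult_strict_right_mono) auto
      moreover have "real M * T / 2 ^ m = T / 2 ^ n"
        using nm power_add[of "2::real" "m - n" n] by (simp add: M_def)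
      ultimately have "\<bar>node T m k - node T m (M * (k div M))\<bar> < T / 2 ^ n"
        using T by simp
      then show "norm (v m k - w k) \<le> \<epsilon>"
        unfolding v_def w_def using k order_trans[OF div_le[of k] k] by (intro \<epsilon> in_T) auto
    qed
    also have "\<dots> \<le> 2 * \<epsilon> * (2 * R T)"
    proof -
      have "(\<Sum>k<i m t. norm (v m (Suc k) - v m k)) \<le> R T"
        unfolding v_def by (rule sum_R0[OF in_T]) (auto intro: node_mono[OF T])
      moreover have "(\<Sum>k<i m t. norm (w (Suc k) - w k)) \<le> R T"
        unfolding v_def w_def
      proof (rule sum_R0)
        show "node T m (M * (k div M)) \<in> {0..T}" if "k \<le> i m t" for k
          using order_trans[OF div_le that] by (rule in_T)
        show "node T m (M * (k div M)) \<le> node T m (M * (Suc k div M))" for k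
          by (intro node_mono[OF T] mult_le_mono2 div_le_mono) simp
      qed
      ultimately show ?thesis
        using \<open>0 \<le> \<epsilon>\<close> by (intro mult_left_mono) (auto simp: sum.distrib)
    qed
    finally show ?thesis unfolding w \<Xi>_def by (simp add: norm_minus_commute)
  qed

  have conv: "convergent (\<lambda>n. \<Xi> n t)" if t: "t \<in> {0..T}" for t
  proof (rule Cauchy_convergent, rule CauchyI')
    fix e :: real assume "e > 0"
    have RT: "0 \<le> R T" using R_mono[of 0 T] R0 T by simp
    \<comment> \<open>Solves \<open>4 * \<epsilon> * (R T + 1) = e\<^sup>2\<close>, where 4 is the
      constant of \<open>compare\<close>; the added 1 keeps the denominator positive and the final
      inequality strict.\<close>
    define \<epsilon> where "\<epsilon> = e\<^sup>2 / (4 * (R T + 1))"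
    have \<epsilon>: "\<epsilon> > 0" using \<open>e > 0\<close> RT by (simp add: \<epsilon>_def)
    have "uniformly_continuous_on {0..T} \<pi>" using \<pi>_cont by (auto intro: compact_uniformly_continuous)
    then obtain d where d: "d > 0" "\<And>a b. a \<in> {0..T} \<Longrightarrow> b \<in> {0..T} \<Longrightarrow> dist b a < d \<Longrightarrow> dist (\<pi> b) (\<pi> a) < \<epsilon>"
      using \<epsilon> unfolding uniformly_continuous_on_def by metis
    have "(\<lambda>n. T * (1 / 2) ^ n) \<longlonglongrightarrow> T * 0"
      by (intro tendsto_intros LIMSEQ_realpow_zero) auto
    then have "\<forall>\<^sub>F n in sequentially. T * (1 / 2) ^ n < d"
      using d(1) by (intro order_tendstoD(2)) auto
    then obtain N where N: "\<And>n. n \<ge> N \<Longrightarrow> T / 2 ^ n < d"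
      by (auto simp: eventually_sequentially power_one_over)
    have "norm (\<Xi> n t - \<Xi> m t) < e" if "N \<le> n" "n < m" for n m
    proof (rule power2_less_imp_less)
      have "(norm (\<Xi> n t - \<Xi> m t))\<^sup>2 \<le> 2 * \<epsilon> * (2 * R T)"
        using that d(2) N[of n] t
        by (intro compare) (force simp: dist_norm intro: less_imp_le)+
      also have "\<dots> < 4 * \<epsilon> * (R T + 1)" using \<epsilon> by simp
      also have "\<dots> = e\<^sup>2" using RT unfolding \<epsilon>_def by (simp add: divide_simps)
      finally show "(norm (\<Xi> n t - \<Xi> m t))\<^sup>2 < e\<^sup>2" .
    qed (use \<open>e > 0\<close> in simp)
    then show "\<exists>N. \<forall>n\<ge>N. \<forall>m>n. dist (\<Xi> n t) (\<Xi> m t) < e" unfolding dist_norm by blast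
  qed
  define \<xi> where "\<xi> t = lim (\<lambda>n. \<Xi> n t)" for t
  have \<Xi>: "(\<lambda>n. \<Xi> n t) \<longlonglongrightarrow> \<xi> t" if "t \<in> {0..T}" for t
    using conv[OF that] unfolding \<xi>_def by (simp add: convergent_LIMSEQ_iff)
  define \<tau> where "\<tau> t = \<pi> t - \<xi> t" for t
  have X_lim: "(\<lambda>n. X n t) \<longlonglongrightarrow> \<tau> t" if "t \<in> {0..T}" for t
    unfolding X \<tau>_def by (intro tendsto_diff v_node \<Xi> that)

  have \<xi>_R: "norm (\<xi> t - \<xi> s) \<le> integral {s..t} \<rho>" if st: "0 \<le> s" "s \<le> t" "t \<le> T" for s t
  proof -
    have "norm (\<Xi> n t - \<Xi> n s) \<le> R (node T n (i n t)) - R (node T n (i n s))" for n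
    proof -
      have "norm (\<Xi> n t - \<Xi> n s) \<le> (\<Sum>k=i n s..<i n t. norm (plastic C (v n) (Suc k) - plastic C (v n) k))"
        unfolding \<Xi>_def using node_index_mono[OF T st(2)] by (intro norm_diff_le_sum_increments) (simp add: i_def)
      also have "\<dots> \<le> (\<Sum>k=i n s..<i n t. norm (v n (Suc k) - v n k))"
        by (intro sum_mono norm_plastic_increment[OF C])
      finally show ?thesis using sum_v[OF st, of n] by linarith
    qed
    moreover have "(\<lambda>n. norm (\<Xi> n t - \<Xi> n s)) \<longlonglongrightarrow> norm (\<xi> t - \<xi> s)"
      "(\<lambda>n. R (node T n (i n t)) - R (node T n (i n s))) \<longlonglongrightarrow> R t - R s"
      using st by (auto intro!: tendsto_intros \<Xi> R_node)
    ultimately have "norm (\<xi> t - \<xi> s) \<le> R t - R s" by (meson LIMSEQ_le)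
    then show ?thesis using is_primitive_diff[OF R st] by simp
  qed
  obtain r where r: "is_primitive T \<xi> r"
    using dominated_increments_imp_integral[OF less_imp_le[OF T] \<rho> \<rho>_nonneg \<xi>_R]
    unfolding is_primitive_def by blast

  have variational: "(\<xi> t - \<xi> s) \<bullet> (z - \<tau> s) \<le> (R t - R s)\<^sup>2"
    if st: "0 \<le> s" "s \<le> t" "t \<le> T" and z: "z \<in> C" for s t z
  proof -
    have "(\<Xi> n t - \<Xi> n s) \<bullet> (z - X n s) \<le> (R (node T n (i n t)) - R (node T n (i n s)))\<^sup>2" for n
    proof -
      have "(\<Xi> n t - \<Xi> n s) \<bullet> (z - X n s) \<le> (\<Sum>k=i n s..<i n t. norm (v n (Suc k) - v n k))\<^sup>2"
        unfolding \<Xi>_def X_def using node_index_mono[OF T st(2)]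
        by (intro plastic_variational_inequality[OF C _ z]) (simp add: i_def)
      also have "\<dots> \<le> (R (node T n (i n t)) - R (node T n (i n s)))\<^sup>2"
        using sum_v[OF st, of n] by (intro power_mono sum_nonneg) auto
      finally show ?thesis .
    qed
    moreover have "(\<lambda>n. (\<Xi> n t - \<Xi> n s) \<bullet> (z - X n s)) \<longlonglongrightarrow> (\<xi> t - \<xi> s) \<bullet> (z - \<tau> s)"
      "(\<lambda>n. (R (node T n (i n t)) - R (node T n (i n s)))\<^sup>2) \<longlonglongrightarrow> (R t - R s)\<^sup>2"
      using st by (auto intro!: tendsto_intros \<Xi> R_node X_lim)
    ultimately show ?thesis by (meson LIMSEQ_le)
  qed

  obtain N1 where N1: "negligible N1"
    "\<And>t. t \<in> {0<..<T} - N1 \<Longrightarrow> ((\<lambda>h. (\<xi> (t + h) - \<xi> t) /\<^sub>R h) \<longlongrightarrow> r t) (at_right 0)"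
    using is_primitive_ae_right_derivative[OF r] by blast
  obtain N2 where N2: "negligible N2"
    "\<And>t. t \<in> {0<..<T} - N2 \<Longrightarrow> ((\<lambda>h. (R (t + h) - R t) /\<^sub>R h) \<longlongrightarrow> \<rho> t) (at_right 0)"
    using is_primitive_ae_right_derivative[OF R] by blast
  have normal: "r t \<in> normal_cone C (\<tau> t)" if t: "t \<in> {0<..<T} - (N1 \<union> N2)" for t
    unfolding normal_cone_def
  proof (intro CollectI ballI)
    fix z assume z: "z \<in> C"
    have "((\<lambda>h. ((\<xi> (t + h) - \<xi> t) /\<^sub>R h) \<bullet> (z - \<tau> t)) \<longlongrightarrow> r t \<bullet> (z - \<tau> t)) (at_right 0)"
      using t by (intro tendsto_intros N1(2)) auto
    \<comment> \<open>The quadratic error divided by \<open>h\<close> is the squared difference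
      quotient of \<open>R\<close> times \<open>h\<close>; at a differentiability point of
      \<open>R\<close> the quotient converges, so the product tends to zero.\<close>
    moreover have "((\<lambda>h. ((R (t + h) - R t) /\<^sub>R h)\<^sup>2 * h) \<longlongrightarrow> (\<rho> t)\<^sup>2 * 0) (at_right 0)"
      using t by (intro tendsto_intros N2(2)) auto
    moreover have "\<forall>\<^sub>F h in at_right 0. ((\<xi> (t + h) - \<xi> t) /\<^sub>R h) \<bullet> (z - \<tau> t) \<le> ((R (t + h) - R t) /\<^sub>R h)\<^sup>2 * h"
    proof (rule eventually_at_rightI)
      show "0 < T - t" using t by simp
      fix h assume h: "h \<in> {0<..<T - t}"
      have "(\<xi> (t + h) - \<xi> t) \<bullet> (z - \<tau> t) / h \<le> (R (t + h) - R t)\<^sup>2 / h"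
        using h t by (intro divide_right_mono variational z) auto
      moreover have "(a /\<^sub>R h) \<bullet> b = a \<bullet> b / h" "(d /\<^sub>R h)\<^sup>2 * h = d\<^sup>2 / h" for a b :: 'a and d :: real
        using h by (simp_all add: field_simps power2_eq_square)
      ultimately show "((\<xi> (t + h) - \<xi> t) /\<^sub>R h) \<bullet> (z - \<tau> t) \<le> ((R (t + h) - R t) /\<^sub>R h)\<^sup>2 * h"
        by (simp only:)
    qed
    ultimately show "r t \<bullet> (z - \<tau> t) \<le> 0"
      using tendsto_le[OF trivial_limit_at_right_real] by fastforce
  qed

  \<comment> \<open>The restriction fixes the values outside the interval as
    \<open>history_operator\<close> prescribes.\<close>
  define \<sigma> where "\<sigma> = restrict \<tau> {0..T}"
  have \<sigma>: "\<sigma> t = \<tau> t" if "t \<in> {0..T}" for t using that by (simp add: \<sigma>_def)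
  have \<sigma>_prim: "is_primitive T \<sigma> (\<lambda>t. p t - r t)"
    using T \<sigma> by (intro is_primitive_cong[OF is_primitive_minus[OF p r]]) (auto simp: \<tau>_def)
  have \<sigma>_C: "\<sigma> t \<in> C" if "t \<in> {0..T}" for t
    unfolding \<sigma>[OF that]
    using closed_sequentially[OF C(2) _ X_lim[OF that]] catch_up_in[OF C] by (simp add: X_def)
  have "X n 0 = closest_point C (\<pi> 0)" for n
    by (simp add: X_def i_def node_index_0 v_def node_0)
  then have "\<tau> 0 = closest_point C (\<pi> 0)"
    using X_lim[of 0] T LIMSEQ_unique[OF _ tendsto_const] by simp
  then have \<sigma>0: "\<sigma> 0 = closest_point C (\<pi> 0)" using T by (simp add: \<sigma>)
  have "sweeping_solution C T \<pi> \<sigma>"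
    unfolding sweeping_solution_def W11_def
  proof (intro conjI CollectI exI ballI \<sigma>_C \<sigma>0)
    show "abs_continuous_on_interval 0 T \<sigma>" by (rule is_primitive_imp_abs_continuous[OF \<sigma>_prim])
    \<comment> \<open>The goal occurs twice: as membership in \<open>W11\<close> and as the
      derivative in the inclusion, where \<open>p t - (p t - r t)\<close> leaves the normal vector
      \<open>r t\<close>.\<close>
    show "has_weak_derivative T \<sigma> (\<lambda>t. p t - r t)" "has_weak_derivative T \<sigma> (\<lambda>t. p t - r t)"
      "has_weak_derivative T \<pi> p"
      using is_primitive_imp_has_weak_derivative[OF less_imp_le[OF T]] \<sigma>_prim p by auto
    show "AE t in lebesgue_on {0<..<T}. p t - (p t - r t) \<in> normal_cone C (\<sigma> t)"
      unfolding AE_lebesgue_on_Ioo_iff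
      using N1(1) N2(1) normal \<sigma> by (intro exI[of _ "N1 \<union> N2"]) auto
  qed
  moreover have "(\<lambda>n. catch_up_at C T \<pi> n t) \<longlonglongrightarrow> \<sigma> t" if "t \<in> {0..T}" for t
    using X_lim[OF that] \<sigma>[OF that] by (simp add: catch_up_at_def X_def v_def[abs_def] i_def)
  moreover have "\<sigma> \<in> extensional {0..T}" by (simp add: \<sigma>_def)
  ultimately show ?thesis by blast
qed

text \<open>Two solutions agree on \<open>{0..T}\<close> and, being extensional, are equal as
  functions; so the definite description picks out the limit of the schemes. From here on only
  pointwise limits are needed.\<close>

lemma
  fixes C :: "'a::euclidean_space set"
  assumes T: "0 < T" and C: "C \<noteq> {}" "closed C" "convex C" and \<pi>: "\<pi> \<in> W11 T UNIV"
  shows history_operator_sweeping_solution: "sweeping_solution C T \<pi> (history_operator C T \<pi>)"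
    and catch_up_at_tendsto_history_operator:
      "t \<in> {0..T} \<Longrightarrow> (\<lambda>n. catch_up_at C T \<pi> n t) \<longlonglongrightarrow> history_operator C T \<pi> t"
proof -
  obtain \<sigma> where \<sigma>: "\<sigma> \<in> extensional {0..T}" "sweeping_solution C T \<pi> \<sigma>"
      "\<And>t. t \<in> {0..T} \<Longrightarrow> (\<lambda>n. catch_up_at C T \<pi> n t) \<longlonglongrightarrow> \<sigma> t"
    using catch_up_scheme_converges[OF T C \<pi>] by blast
  have "history_operator C T \<pi> = \<sigma>"
    unfolding history_operator_def
  proof (rule the_equality)
    show "\<sigma> \<in> extensional {0..T} \<and> sweeping_solution C T \<pi> \<sigma>" using \<sigma> by blast
    fix \<sigma>' assume "\<sigma>' \<in> extensional {0..T} \<and> sweeping_solution C T \<pi> \<sigma>'"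
    then show "\<sigma>' = \<sigma>"
      using \<sigma>(1,2) sweeping_solution_unique[OF T \<pi>] by (blast intro: extensionalityI)
  qed
  then show "sweeping_solution C T \<pi> (history_operator C T \<pi>)"
    "t \<in> {0..T} \<Longrightarrow> (\<lambda>n. catch_up_at C T \<pi> n t) \<longlonglongrightarrow> history_operator C T \<pi> t"
    using \<sigma> by auto
qed

theorem theorem2p12:
  fixes C :: "'a::euclidean_space set" and T :: real
  assumes "T > 0" and "C \<noteq> {}" and "closed C" and "convex C"
  shows "(\<forall>\<pi>\<in>W11 T UNIV. \<forall>t\<in>{0..T}. history_operator C T \<pi> t \<in> C) \<and>
    (\<forall>\<pi>1\<in>W11 T UNIV. \<forall>\<pi>2\<in>W11 T UNIV. \<forall>ts\<in>{0..T}.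
       (\<forall>t\<in>{0..ts}. \<pi>1 t = \<pi>2 t) \<longrightarrow>
       (\<forall>t\<in>{0..ts}. history_operator C T \<pi>1 t = history_operator C T \<pi>2 t)) \<and>
    (\<forall>\<pi>1\<in>W11 T UNIV. \<forall>\<pi>2\<in>W11 T UNIV.
       Linf_norm T (\<lambda>t. history_operator C T \<pi>1 t - history_operator C T \<pi>2 t)
         \<le> ennreal (norm (\<pi>1 0 - \<pi>2 0)) + variation T (\<lambda>t. \<pi>1 t - \<pi>2 t) \<and>
       Linf_norm T (\<lambda>t. history_operator C T \<pi>1 t - history_operator C T \<pi>2 t)
         \<le> bv_norm0 T (\<lambda>t. \<pi>1 t - \<pi>2 t)) \<and>
    (\<forall>\<pi>\<in>W11 T UNIV. variation T (history_operator C T \<pi>) \<le> variation T \<pi>)"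
proof -
  note T = assms(1) and C = assms(2-4)
  let ?P = "history_operator C T"
  note lim = catch_up_at_tendsto_history_operator[OF T C]
  have W11: "?P \<pi> \<in> W11 T C" if "\<pi> \<in> W11 T UNIV" for \<pi>
    using history_operator_sweeping_solution[OF T C that] by (simp add: sweeping_solution_def)
  have range: "?P \<pi> t \<in> C" if "\<pi> \<in> W11 T UNIV" "t \<in> {0..T}" for \<pi> t
    using W11[OF that(1)] that(2) by (simp add: W11_def)
  have causal: "?P \<pi>1 t = ?P \<pi>2 t"
    if \<pi>: "\<pi>1 \<in> W11 T UNIV" "\<pi>2 \<in> W11 T UNIV" and eq: "\<forall>s\<in>{0..ts}. \<pi>1 s = \<pi>2 s"
      and ts: "ts \<in> {0..T}" and t: "t \<in> {0..ts}" for \<pi>1 \<pi>2 ts t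
  proof -
    have "catch_up_at C T \<pi>1 n t = catch_up_at C T \<pi>2 n t" for n
      unfolding catch_up_at_def
    proof (rule catch_up_cong)
      fix k assume "k \<le> node_index T n t"
      then have "node T n k \<le> t"
        using node_mono[OF T, of k "node_index T n t" n] node_node_index(1)[OF T, of t n] t by simp
      then show "\<pi>1 (node T n k) = \<pi>2 (node T n k)" using node_nonneg[OF T, of n k] eq t by simp
    qed
    moreover have "t \<in> {0..T}" using t ts by simp
    ultimately show ?thesis
      using lim[OF \<pi>(1), of t] lim[OF \<pi>(2), of t] by (simp add: LIMSEQ_unique)
  qed
  have stable: "ennreal (norm (?P \<pi>1 t - ?P \<pi>2 t))
      \<le> ennreal (norm (\<pi>1 0 - \<pi>2 0)) + variation T (\<lambda>t. \<pi>1 t - \<pi>2 t)"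
    if \<pi>: "\<pi>1 \<in> W11 T UNIV" "\<pi>2 \<in> W11 T UNIV" and t: "t \<in> {0..T}" for \<pi>1 \<pi>2 t
  proof (rule LIMSEQ_le_const2)
    show "(\<lambda>n. ennreal (norm (catch_up_at C T \<pi>1 n t - catch_up_at C T \<pi>2 n t)))
        \<longlonglongrightarrow> ennreal (norm (?P \<pi>1 t - ?P \<pi>2 t))"
      by (intro tendsto_ennrealI tendsto_intros lim \<pi> t)
    have "ennreal (norm (catch_up_at C T \<pi>1 n t - catch_up_at C T \<pi>2 n t))
        \<le> ennreal (norm (\<pi>1 0 - \<pi>2 0)) + variation T (\<lambda>t. \<pi>1 t - \<pi>2 t)" for n
    proof -
      let ?inc = "\<lambda>k. norm ((\<pi>1 (node T n (Suc k)) - \<pi>2 (node T n (Suc k))) - (\<pi>1 (node T n k) - \<pi>2 (node T n k)))"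
      have "norm (catch_up_at C T \<pi>1 n t - catch_up_at C T \<pi>2 n t)
          \<le> norm (\<pi>1 0 - \<pi>2 0) + (\<Sum>k<node_index T n t. ?inc k)"
        using catch_up_stability[OF C, where v = "\<lambda>k. \<pi>1 (node T n k)" and w = "\<lambda>k. \<pi>2 (node T n k)" and n = "node_index T n t"]
        by (simp add: catch_up_at_def node_0)
      \<comment> \<open>Extending the sum to all cells turns it into a sum over a full partition of
        \<open>{0..T}\<close>, bounded by the variation of the difference.\<close>
      also have "\<dots> \<le> norm (\<pi>1 0 - \<pi>2 0) + (\<Sum>k<2 ^ n. ?inc k)"
        using node_index_le[OF T, of t n] t by (intro add_left_mono sum_mono2) auto
      finally have "ennreal (norm (catch_up_at C T \<pi>1 n t - catch_up_at C T \<pi>2 n t))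
          \<le> ennreal (norm (\<pi>1 0 - \<pi>2 0)) + ennreal (\<Sum>k<2 ^ n. ?inc k)"
        by (simp add: ennreal_leI sum_nonneg flip: ennreal_plus)
      also have "\<dots> \<le> ennreal (norm (\<pi>1 0 - \<pi>2 0)) + variation T (\<lambda>t. \<pi>1 t - \<pi>2 t)"
        by (intro add_left_mono sum_norm_nodes_le_variation[OF T, of "\<lambda>t. \<pi>1 t - \<pi>2 t" n])
      finally show ?thesis .
    qed
    then show "\<exists>N. \<forall>n\<ge>N. ennreal (norm (catch_up_at C T \<pi>1 n t - catch_up_at C T \<pi>2 n t))
        \<le> ennreal (norm (\<pi>1 0 - \<pi>2 0)) + variation T (\<lambda>t. \<pi>1 t - \<pi>2 t)" by blast
  qed
  have Linf: "Linf_norm T (\<lambda>t. ?P \<pi>1 t - ?P \<pi>2 t)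
      \<le> ennreal (norm (\<pi>1 0 - \<pi>2 0)) + variation T (\<lambda>t. \<pi>1 t - \<pi>2 t)"
    if \<pi>: "\<pi>1 \<in> W11 T UNIV" "\<pi>2 \<in> W11 T UNIV" for \<pi>1 \<pi>2
    unfolding Linf_norm_def
  proof (rule esssup_I)
    \<comment> \<open>Continuity supplies the measurability that bounding an essential supremum
      requires.\<close>
    have "continuous_on {0..T} (?P \<pi>)" if "\<pi> \<in> W11 T UNIV" for \<pi>
      using W11[OF that] abs_continuous_imp_continuous by (auto simp: W11_def)
    then have "continuous_on {0..T} (\<lambda>t. norm (?P \<pi>1 t - ?P \<pi>2 t))"
      using \<pi> by (intro continuous_intros) auto
    then have "(\<lambda>t. norm (?P \<pi>1 t - ?P \<pi>2 t)) \<in> borel_measurable (lebesgue_on {0..T})"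
      by (rule continuous_imp_measurable_on_sets_lebesgue) simp
    then show "(\<lambda>t. ennreal (norm (?P \<pi>1 t - ?P \<pi>2 t))) \<in> borel_measurable (lebesgue_on {0..T})"
      by measurable
    show "AE t in lebesgue_on {0..T}. ennreal (norm (?P \<pi>1 t - ?P \<pi>2 t))
        \<le> ennreal (norm (\<pi>1 0 - \<pi>2 0)) + variation T (\<lambda>t. \<pi>1 t - \<pi>2 t)"
      using stable[OF \<pi>] by (intro AE_I2) (simp add: space_restrict_space)
  qed
  have contract: "variation T (?P \<pi>) \<le> variation T \<pi>" if \<pi>: "\<pi> \<in> W11 T UNIV" for \<pi>
    unfolding variation_def[of T "?P \<pi>"]
  proof (rule SUP_least)
    fix mt
    assume "mt \<in> {(m::nat, t::nat \<Rightarrow> real). t 0 = 0 \<and> t m = T \<and> (\<forall>j\<in>{1..m}. t (j - 1) < t j)}"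
    then obtain m t where mt: "mt = (m, t)" and t0: "t 0 = 0" and tm: "T = t m"
      and less: "\<forall>j\<in>{1..m}. t (j - 1) < t j" by auto
    have mono: "t j \<le> t (Suc j)" if "j < m" for j
      using less[rule_format, of "Suc j"] that by simp
    have mono': "t j \<le> t l" if "j \<le> l" "l \<le> m" for j l
      using that by (induction l rule: dec_induct) (auto intro: order_trans[OF _ mono])
    have t_in: "t j \<in> {0..T}" if "j \<le> m" for j
      using mono'[of 0 j] mono'[of j m] that t0 tm by simp
    let ?X = "\<lambda>n j. catch_up_at C T \<pi> n (t j)"
    have "ennreal (\<Sum>j<m. norm (?P \<pi> (t (Suc j)) - ?P \<pi> (t j))) \<le> variation T \<pi>"
    \<comment> \<open>Lower semicontinuity of the variation: for a fixed partition the sum involves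
      finitely many point values, so pointwise convergence suffices.\<close>
    proof (rule LIMSEQ_le_const2)
      show "(\<lambda>n. ennreal (\<Sum>j<m. norm (?X n (Suc j) - ?X n j)))
          \<longlonglongrightarrow> ennreal (\<Sum>j<m. norm (?P \<pi> (t (Suc j)) - ?P \<pi> (t j)))"
        by (intro tendsto_ennrealI tendsto_intros lim \<pi> t_in) auto
      have "ennreal (\<Sum>j<m. norm (?X n (Suc j) - ?X n j)) \<le> variation T \<pi>" for n
      proof -
        let ?v = "\<lambda>k. \<pi> (node T n k)"
        \<comment> \<open>The given partition need not be dyadic; rounding its points down to nodes
          gives a nondecreasing index sequence running from \<open>0\<close> to
          \<open>2 ^ n\<close>.\<close>
        have "(\<Sum>j<m. norm (?X n (Suc j) - ?X n j))
            \<le> (\<Sum>k=node_index T n (t 0)..<node_index T n (t m). norm (catch_up C ?v (Suc k) - catch_up C ?v k))"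
          unfolding catch_up_at_def
          by (rule conjunct2[OF sum_norm_subsequence_le]) (intro node_index_mono[OF T] mono)
        also have "\<dots> = (\<Sum>k<2 ^ n. norm (catch_up C ?v (Suc k) - catch_up C ?v k))"
          unfolding t0 tm[symmetric] node_index_0 node_index_last[OF T] atLeast0LessThan ..
        also have "\<dots> \<le> (\<Sum>k<2 ^ n. norm (?v (Suc k) - ?v k))"
          by (intro sum_mono norm_catch_up_increment[OF C])
        finally show ?thesis
          using sum_norm_nodes_le_variation[OF T, of \<pi> n] ennreal_leI order_trans by blast
      qed
      then show "\<exists>N. \<forall>n\<ge>N. ennreal (\<Sum>j<m. norm (?X n (Suc j) - ?X n j)) \<le> variation T \<pi>" by blast
    qed
    then show "(case mt of (m, t) \<Rightarrow> ennreal (\<Sum>j=1..m. norm (?P \<pi> (t j) - ?P \<pi> (t (j - 1))))) \<le> variation T \<pi>"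
      by (simp add: mt sum.atLeast1_atMost_eq)
  qed
  show ?thesis
    \<comment> \<open>Unfolded, the bound in \<open>bv_norm0\<close> is literally the first bound of
      the stability claim, so \<open>Linf\<close> settles both.\<close>
    unfolding bv_norm0_def
    by (intro conjI ballI impI) (rule range causal Linf contract; assumption)+
qed

end
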